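(* $V^n\nearrow V$ as $n\to\infty$; that is, for every $(x,y)\in\mathbf{R}_+^2$ the sequence $(V^n(x,y))_{n\ge1}$ is non-decreasing and $\lim_{n\to\infty}V^n(x,y)=V(x,y)$.
   Context: Model. $\mathbf{R}_+^2=[0,\infty)^2$. The free surpluses of Company One and Company Two are $X_t=x+p_1t-\sum_{i=1}^{N_t^1}U_i^{(1)}$ and $Y_t=y+p_2t-\sum_{i=1}^{N_t^2}U_i^{(2)}$, with $(x,y)\in\mathbf{R}_+^2$, premium rates $p_1,p_2>0$, Poisson processes $N^k$ with intensities $\lambda_k>0$, and, for each $k=1,2$, i.i.d. positive claim sizes $U_i^{(k)}$ with continuous distribution function $F^k$. The processes $N^1,N^2$ and all claim sizes are independent, and $p_k>\lambda_kE(U_i^{(k)})$. $\delta>0$ is a discount factor, $a_1\in[0,1]$ and $a_2=1-a_1$ are weights. Collaboration and dividends. A dividend strategy is $\overline L=(L_t^1,L_t^2)$, the cumulative dividends of the two companies. The controlled surpluses are $X_t^{\overline L}=X_t-L_t^1+C_t^{2,1}-C_t^{1,2}$, $Y_t^{\overline L}=Y_t-L_t^2+C_t^{1,2}-C_t^{2,1}$, where $C^{2,1}$ (resp. $C^{1,2}$) is the cumulative amount transferred from Two to One (resp. One to Two): whenever a claim of one company makes its surplus negative and the sum of the two surpluses is still $\ge0$, the other company transfers exactly the deficit. Let $\overline\tau=\inf\{t\ge0: X_t^{\overline L}+Y_t^{\overline L}<0\}$; at $\overline\tau$ no transfer occurs, so one surplus is negative (that company is ruined) and the other survives. $\overline L$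 is admissible if each $L^k$ is non-decreasing, left continuous with right limits, starting at $0$, predictable with respect to the filtration generated by $(X_t,Y_t)$, and before $\overline\tau$ satisfies $L_t^1\le X_t+C_t^{2,1}-C_t^{1,2}$ and $L_t^2\le Y_t+C_t^{1,2}-C_t^{2,1}$. $\Pi_{x,y}$ is the set of admissible strategies with initial surplus $(x,y)$. $V_k^0$ ($k=1,2$) is the optimal value function of the one-dimensional problem of maximizing the expected $\delta$-discounted dividends of Company $k$ alone until its ruin, extended by $0$ to $(-\infty,0)$. Put $$V_{\overline L}(x,y)=E_{x,y}\Big(a_1\Big(\int_0^{\overline\tau}e^{-\delta s}dL_s^1+e^{-\delta\overline\tau}V_1^0(X_{\overline\tau}^{\overline L})\Big)+a_2\Big(\int_0^{\overline\tau}e^{-\delta s}dL_s^2+e^{-\delta\overline\tau}V_2^0(Y_{\overline\tau}^{\overline L})\Big)\Big)$$ (integrals include a lump sum paid at time $0$), and $V(x,y)=\sup_{\overline L\in\Pi_{x,y}}V_{\overline L}(x,y)$. Iteration. The take-the-money-and-run strategy $\overline L^0$ pays the entire current surpluses of both companies immediately as dividends and then pays the incoming premiums (rates $p_1$, $p_2$) as dividends until the first claim, at which the company facing the claim is ruined. Let $\tau_n$ be the arrival time of the $n$-th claim regardless of the company (the $n$-th point of $N^1+N^2$). $\Pi_{x,y}^n$ is the set of strategies in $\Pi_{x,y}$ which follow $\overline L^0$ right after $\tau_n$ (if $\tau_n<\overline\tau$), and for $n\ge1$, $V^n(x,y)=\sup_{\overline L\in\Pi_{x,y}^n}V_{\overline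 L}(x,y)$. *)

theory Defs
  imports "HOL-Probability.Probability"
begin

section \<open>Processes on the time axis \<open>[0,\<infinity>)\<close>\<close>

text \<open>A process is a function \<open>Z :: real \<Rightarrow> 'w \<Rightarrow> 'b\<close>, of which only the values at times \<open>t \<ge> 0\<close> matter.\<close>

definition generated_sigma ::
  "'w measure \<Rightarrow> 'i set \<Rightarrow> ('i \<Rightarrow> 'w \<Rightarrow> 'b) \<Rightarrow> 'b measure \<Rightarrow> 'w measure" where
  "generated_sigma M I Z K = sigma (space M) {Z i -` B \<inter> space M | i B. i \<in> I \<and> B \<in> sets K}"

definition natural_filtration ::
  "'w measure \<Rightarrow> (real \<Rightarrow> 'w \<Rightarrow> 'b::topological_space) \<Rightarrow> real \<Rightarrow> 'w measure" where
  "natural_filtration M Z t = generated_sigma M {0..t} Z borel"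

definition predictable_sigma :: "(real \<Rightarrow> 'w measure) \<Rightarrow> (real \<times> 'w) measure" where
  "predictable_sigma \<F> = sigma ({0..} \<times> space (\<F> 0))
     ({{0} \<times> A | A. A \<in> sets (\<F> 0)} \<union>
      {{s<..t} \<times> A | s t A. 0 \<le> s \<and> s < t \<and> A \<in> sets (\<F> s)})"

definition predictable :: "(real \<Rightarrow> 'w measure) \<Rightarrow> (real \<Rightarrow> 'w \<Rightarrow> real) \<Rightarrow> bool" where
  "predictable \<F> L \<longleftrightarrow> (\<lambda>(t, \<omega>). L t \<omega>) \<in> borel_measurable (predictable_sigma \<F>)"

text \<open>The value is \<open>\<infinity>\<close> if \<open>P\<close> never holds.\<close>

definition first_time :: "(real \<Rightarrow> bool) \<Rightarrow> ereal" where
  "first_time P = Inf (ereal ` {t. 0 \<le> t \<and> P t})"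

text \<open>The paths are those of a counting process (right-continuous, unit jumps) for every \<open>\<omega>\<close>,
  not only almost surely.\<close>

definition (in prob_space) poisson_process :: "real \<Rightarrow> (real \<Rightarrow> 'a \<Rightarrow> nat) \<Rightarrow> bool" where
  "poisson_process \<kappa> N \<longleftrightarrow>
     (\<forall>t\<ge>0. N t \<in> measurable M (count_space UNIV)) \<and>
     (\<forall>\<omega>\<in>space M. N 0 \<omega> = 0 \<and> mono_on {0..} (\<lambda>t. N t \<omega>) \<and>
        (\<forall>t\<ge>0. \<forall>\<^sub>F s in at_right t. N s \<omega> = N t \<omega>) \<and>
        (\<forall>t>0. \<forall>\<^sub>F s in at_left t. N t \<omega> \<le> Suc (N s \<omega>))) \<and>
     (\<forall>ts::nat \<Rightarrow> real. 0 \<le> ts 0 \<and> incseq ts \<longrightarrow>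
        indep_vars (\<lambda>_. count_space UNIV) (\<lambda>i \<omega>. N (ts (Suc i)) \<omega> - N (ts i) \<omega>) UNIV) \<and>
     (\<forall>s t. 0 \<le> s \<and> s < t \<longrightarrow>
        distr M (count_space UNIV) (\<lambda>\<omega>. N t \<omega> - N s \<omega>) = measure_pmf (poisson_pmf (\<kappa> * (t - s))))"

section \<open>Dividends\<close>

definition dividend_process ::
  "'w measure \<Rightarrow> (real \<Rightarrow> 'w measure) \<Rightarrow> (real \<Rightarrow> 'w \<Rightarrow> real) \<Rightarrow> bool" where
  "dividend_process M \<F> L \<longleftrightarrow> predictable \<F> L \<and>
     (\<forall>\<omega>\<in>space M. L 0 \<omega> = 0 \<and> mono_on {0..} (\<lambda>t. L t \<omega>) \<and>
        (\<forall>t>0. continuous (at_left t) (\<lambda>s. L s \<omega>)) \<and>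
        (\<forall>t\<ge>0. \<exists>l. ((\<lambda>s. L s \<omega>) \<longlongrightarrow> l) (at_right t)))"

text \<open>For a left-continuous non-decreasing path \<open>l\<close> with \<open>l 0 = 0\<close>, the integral of
  \<open>exp (- \<delta> s)\<close> with respect to \<open>dl\<close> over \<open>[0,T)\<close>. Since \<^const>\<open>interval_measure\<close> expects a
  right-continuous distribution function, it is applied to the right limits of \<open>l\<close>, extended by
  0 to negative times: the lump sum \<open>l (t+) - l t\<close> paid at time \<open>t\<close> (also at \<open>t = 0\<close>) becomes an
  atom at \<open>t\<close>. A lump sum at time \<open>T\<close> itself is not part of \<open>l T\<close> and is not counted.\<close>

definition discounted_dividends :: "real \<Rightarrow> (real \<Rightarrow> real) \<Rightarrow> ereal \<Rightarrow> ennreal" where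
  "discounted_dividends \<delta> l T =
     (\<integral>\<^sup>+ s\<in>{s. 0 \<le> s \<and> ereal s < T}. ennreal (exp (- \<delta> * s))
        \<partial>interval_measure (\<lambda>t. if t < 0 then 0 else Lim (at_right t) l))"

text \<open>A payment of \<open>v T\<close> at time \<open>T\<close>, discounted; it vanishes for \<open>T = \<infinity>\<close>.\<close>

definition discounted_at :: "real \<Rightarrow> (real \<Rightarrow> ennreal) \<Rightarrow> ereal \<Rightarrow> ennreal" where
  "discounted_at \<delta> v T =
     (if T = \<infinity> then 0 else ennreal (exp (- \<delta> * real_of_ereal T)) * v (real_of_ereal T))"

section \<open>A single company\<close>

definition surplus ::
  "real \<Rightarrow> (real \<Rightarrow> 'w \<Rightarrow> nat) \<Rightarrow> (nat \<Rightarrow> 'w \<Rightarrow> real) \<Rightarrow> real \<Rightarrow> real \<Rightarrow> 'w \<Rightarrow> real" where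
  "surplus p N U u t \<omega> = u + p * t - (\<Sum>i<N t \<omega>. U i \<omega>)"

definition single_ruin ::
  "real \<Rightarrow> (real \<Rightarrow> 'w \<Rightarrow> nat) \<Rightarrow> (nat \<Rightarrow> 'w \<Rightarrow> real) \<Rightarrow> real \<Rightarrow> (real \<Rightarrow> 'w \<Rightarrow> real) \<Rightarrow> 'w \<Rightarrow> ereal" where
  "single_ruin p N U u L \<omega> = first_time (\<lambda>t. surplus p N U u t \<omega> - L t \<omega> < 0)"

text \<open>As \<open>L\<close> is left-continuous, the bound before ruin does not by itself exclude a lump sum that
  exceeds the surplus and so causes ruin right after its payment. This is excluded by the last
  condition (the surplus is negative at the time of ruin), which says that ruin occurs at a claim.\<close>

definition single_strategies ::
  "'w measure \<Rightarrow> real \<Rightarrow> (real \<Rightarrow> 'w \<Rightarrow> nat) \<Rightarrow> (nat \<Rightarrow> 'w \<Rightarrow> real) \<Rightarrow> real \<Rightarrow>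
   (real \<Rightarrow> 'w \<Rightarrow> real) set" where
  "single_strategies M p N U u = {L.
     dividend_process M (natural_filtration M (surplus p N U u)) L \<and>
     (\<forall>\<omega>\<in>space M.
        (\<forall>t\<ge>0. ereal t < single_ruin p N U u L \<omega> \<longrightarrow> L t \<omega> \<le> surplus p N U u t \<omega>) \<and>
        (\<forall>t. single_ruin p N U u L \<omega> = ereal t \<longrightarrow> surplus p N U u t \<omega> - L t \<omega> < 0))}"

definition single_value ::
  "'w measure \<Rightarrow> real \<Rightarrow> (real \<Rightarrow> 'w \<Rightarrow> nat) \<Rightarrow> (nat \<Rightarrow> 'w \<Rightarrow> real) \<Rightarrow> real \<Rightarrow> real \<Rightarrow> ennreal" where
  "single_value M p N U \<delta> u = (if u < 0 then 0 else
     (SUP L\<in>single_strategies M p N U u.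
        \<integral>\<^sup>+ \<omega>. discounted_dividends \<delta> (\<lambda>t. L t \<omega>) (single_ruin p N U u L \<omega>) \<partial>M))"

section \<open>Two collaborating companies\<close>

datatype risk_source = Arrivals1 | Arrivals2 | Claim1 nat | Claim2 nat

text \<open>The claim sizes are indexed from 0: \<open>U1 i\<close> is the size of the claim number \<open>i + 1\<close> of
  Company One.\<close>

locale two_company_model = prob_space M
  for M :: "'w measure" +
  fixes p1 p2 \<kappa>1 \<kappa>2 :: real
    and F1 F2 :: "real \<Rightarrow> real"
    and N1 N2 :: "real \<Rightarrow> 'w \<Rightarrow> nat"
    and U1 U2 :: "nat \<Rightarrow> 'w \<Rightarrow> real"
    and \<delta> a1 a2 :: real
  assumes premium_pos: "0 < p1" "0 < p2"
    and intensity_pos: "0 < \<kappa>1" "0 < \<kappa>2"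
    and arrivals: "poisson_process \<kappa>1 N1" "poisson_process \<kappa>2 N2"
    and claims_measurable: "\<And>i. random_variable borel (U1 i)" "\<And>i. random_variable borel (U2 i)"
    and claims_pos: "\<And>i \<omega>. \<omega> \<in> space M \<Longrightarrow> 0 < U1 i \<omega>" "\<And>i \<omega>. \<omega> \<in> space M \<Longrightarrow> 0 < U2 i \<omega>"
    and claims_cdf: "\<And>i. cdf (distr M borel (U1 i)) = F1" "\<And>i. cdf (distr M borel (U2 i)) = F2"
    and cdf_continuous: "continuous_on UNIV F1" "continuous_on UNIV F2"
    and independent: "indep_sets (\<lambda>r. case r of
          Arrivals1 \<Rightarrow> sets (generated_sigma M {0..} N1 (count_space UNIV))
        | Arrivals2 \<Rightarrow> sets (generated_sigma M {0..} N2 (count_space UNIV))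
        | Claim1 i \<Rightarrow> sets (generated_sigma M {i} U1 borel)
        | Claim2 i \<Rightarrow> sets (generated_sigma M {i} U2 borel)) UNIV"
    and claims_integrable: "\<And>i. integrable M (U1 i)" "\<And>i. integrable M (U2 i)"
    and net_profit: "\<And>i. \<kappa>1 * expectation (U1 i) < p1" "\<And>i. \<kappa>2 * expectation (U2 i) < p2"
    and discount_pos: "0 < \<delta>"
    and weights: "0 \<le> a1" "a1 \<le> 1" "a2 = 1 - a1"
begin

abbreviation X :: "real \<Rightarrow> real \<Rightarrow> 'w \<Rightarrow> real" where
  "X x \<equiv> surplus p1 N1 U1 x"

abbreviation Y :: "real \<Rightarrow> real \<Rightarrow> 'w \<Rightarrow> real" where
  "Y y \<equiv> surplus p2 N2 U2 y"

definition claim_time :: "nat \<Rightarrow> 'w \<Rightarrow> ereal" where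
  "claim_time n \<omega> = first_time (\<lambda>t. n \<le> N1 t \<omega> + N2 t \<omega>)"

text \<open>The cumulative transfers \<open>(C21, C12)\<close> right after the first \<open>n\<close> claims, where \<open>C21\<close> goes from
  Two to One. Each step settles one claim: \<open>x'\<close> and \<open>y'\<close> are the surpluses just after that claim,
  before any transfer caused by it. If \<open>x' + y' \<ge> 0\<close>, then at most one of them is negative and its
  deficit is transferred.\<close>

primrec transfers ::
  "real \<Rightarrow> real \<Rightarrow> (real \<Rightarrow> 'w \<Rightarrow> real) \<Rightarrow> (real \<Rightarrow> 'w \<Rightarrow> real) \<Rightarrow> 'w \<Rightarrow> nat \<Rightarrow> real \<times> real" where
  "transfers x y L1 L2 \<omega> 0 = (0, 0)"
| "transfers x y L1 L2 \<omega> (Suc n) =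
     (let (c21, c12) = transfers x y L1 L2 \<omega> n;
          t = real_of_ereal (claim_time (Suc n) \<omega>);
          x' = X x t \<omega> - L1 t \<omega> + c21 - c12;
          y' = Y y t \<omega> - L2 t \<omega> + c12 - c21
      in if 0 \<le> x' + y' then (c21 + max 0 (- x'), c12 + max 0 (- y')) else (c21, c12))"

definition C21 ::
  "real \<Rightarrow> real \<Rightarrow> (real \<Rightarrow> 'w \<Rightarrow> real) \<Rightarrow> (real \<Rightarrow> 'w \<Rightarrow> real) \<Rightarrow> real \<Rightarrow> 'w \<Rightarrow> real" where
  "C21 x y L1 L2 t \<omega> = fst (transfers x y L1 L2 \<omega> (N1 t \<omega> + N2 t \<omega>))"

definition C12 ::
  "real \<Rightarrow> real \<Rightarrow> (real \<Rightarrow> 'w \<Rightarrow> real) \<Rightarrow> (real \<Rightarrow> 'w \<Rightarrow> real) \<Rightarrow> real \<Rightarrow> 'w \<Rightarrow> real" where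
  "C12 x y L1 L2 t \<omega> = snd (transfers x y L1 L2 \<omega> (N1 t \<omega> + N2 t \<omega>))"

definition controlled_X ::
  "real \<Rightarrow> real \<Rightarrow> (real \<Rightarrow> 'w \<Rightarrow> real) \<Rightarrow> (real \<Rightarrow> 'w \<Rightarrow> real) \<Rightarrow> real \<Rightarrow> 'w \<Rightarrow> real" where
  "controlled_X x y L1 L2 t \<omega> = X x t \<omega> - L1 t \<omega> + C21 x y L1 L2 t \<omega> - C12 x y L1 L2 t \<omega>"

definition controlled_Y ::
  "real \<Rightarrow> real \<Rightarrow> (real \<Rightarrow> 'w \<Rightarrow> real) \<Rightarrow> (real \<Rightarrow> 'w \<Rightarrow> real) \<Rightarrow> real \<Rightarrow> 'w \<Rightarrow> real" where
  "controlled_Y x y L1 L2 t \<omega> = Y y t \<omega> - L2 t \<omega> + C12 x y L1 L2 t \<omega> - C21 x y L1 L2 t \<omega>"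

definition ruin_time ::
  "real \<Rightarrow> real \<Rightarrow> (real \<Rightarrow> 'w \<Rightarrow> real) \<Rightarrow> (real \<Rightarrow> 'w \<Rightarrow> real) \<Rightarrow> 'w \<Rightarrow> ereal" where
  "ruin_time x y L1 L2 \<omega> =
     first_time (\<lambda>t. controlled_X x y L1 L2 t \<omega> + controlled_Y x y L1 L2 t \<omega> < 0)"

text \<open>As for a single company, the last condition says that ruin is not caused by a lump sum
  exceeding the surplus, so that one company is ruined at \<^term>\<open>ruin_time x y L1 L2 \<omega>\<close>.\<close>

definition strategies ::
  "real \<Rightarrow> real \<Rightarrow> ((real \<Rightarrow> 'w \<Rightarrow> real) \<times> (real \<Rightarrow> 'w \<Rightarrow> real)) set" where
  "strategies x y = {(L1, L2).
     dividend_process M (natural_filtration M (\<lambda>t \<omega>. (X x t \<omega>, Y y t \<omega>))) L1 \<and>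
     dividend_process M (natural_filtration M (\<lambda>t \<omega>. (X x t \<omega>, Y y t \<omega>))) L2 \<and>
     (\<forall>\<omega>\<in>space M.
        (\<forall>t\<ge>0. ereal t < ruin_time x y L1 L2 \<omega> \<longrightarrow>
           L1 t \<omega> \<le> X x t \<omega> + C21 x y L1 L2 t \<omega> - C12 x y L1 L2 t \<omega> \<and>
           L2 t \<omega> \<le> Y y t \<omega> + C12 x y L1 L2 t \<omega> - C21 x y L1 L2 t \<omega>) \<and>
        (\<forall>t. ruin_time x y L1 L2 \<omega> = ereal t \<longrightarrow>
           controlled_X x y L1 L2 t \<omega> + controlled_Y x y L1 L2 t \<omega> < 0))}"

text \<open>All payments are nonnegative, so expectations and suprema are taken in
  \<^typ>\<open>ennreal\<close>.\<close>

definition strategy_value ::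
  "real \<Rightarrow> real \<Rightarrow> (real \<Rightarrow> 'w \<Rightarrow> real) \<Rightarrow> (real \<Rightarrow> 'w \<Rightarrow> real) \<Rightarrow> ennreal" where
  "strategy_value x y L1 L2 = (\<integral>\<^sup>+ \<omega>.
     (let T = ruin_time x y L1 L2 \<omega> in
        ennreal a1 * (discounted_dividends \<delta> (\<lambda>t. L1 t \<omega>) T +
          discounted_at \<delta> (\<lambda>t. single_value M p1 N1 U1 \<delta> (controlled_X x y L1 L2 t \<omega>)) T) +
        ennreal a2 * (discounted_dividends \<delta> (\<lambda>t. L2 t \<omega>) T +
          discounted_at \<delta> (\<lambda>t. single_value M p2 N2 U2 \<delta> (controlled_Y x y L1 L2 t \<omega>)) T)) \<partial>M)"

definition optimal_value :: "real \<Rightarrow> real \<Rightarrow> ennreal" where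
  "optimal_value x y = (SUP (L1, L2)\<in>strategies x y. strategy_value x y L1 L2)"

text \<open>Cumulative take-the-money-and-run dividends of a company with premium rate \<open>p\<close>, a time \<open>s\<close>
  after it starts with surplus \<open>u\<close>; left-continuous, with the lump sum \<open>u\<close> paid at \<open>s = 0\<close>.\<close>

definition run_dividends :: "real \<Rightarrow> real \<Rightarrow> real \<Rightarrow> real" where
  "run_dividends p u s = (if s \<le> 0 then 0 else u + p * s)"

text \<open>Strategies that switch to take-the-money-and-run right after claim number \<open>n\<close>. The switch is
  imposed up to ruin, which then occurs at the next claim; later dividends are irrelevant.\<close>

definition strategies_n ::
  "nat \<Rightarrow> real \<Rightarrow> real \<Rightarrow> ((real \<Rightarrow> 'w \<Rightarrow> real) \<times> (real \<Rightarrow> 'w \<Rightarrow> real)) set" where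
  "strategies_n n x y = {(L1, L2). (L1, L2) \<in> strategies x y \<and>
     (\<forall>\<omega>\<in>space M. claim_time n \<omega> < ruin_time x y L1 L2 \<omega> \<longrightarrow>
        (let s = real_of_ereal (claim_time n \<omega>) in
           \<forall>t\<ge>s. ereal t \<le> ruin_time x y L1 L2 \<omega> \<longrightarrow>
             L1 t \<omega> = L1 s \<omega> + run_dividends p1 (controlled_X x y L1 L2 s \<omega>) (t - s) \<and>
             L2 t \<omega> = L2 s \<omega> + run_dividends p2 (controlled_Y x y L1 L2 s \<omega>) (t - s)))}"

definition optimal_value_n :: "nat \<Rightarrow> real \<Rightarrow> real \<Rightarrow> ennreal" where
  "optimal_value_n n x y = (SUP (L1, L2)\<in>strategies_n n x y. strategy_value x y L1 L2)"

end

end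

theory Submission
  imports Defs
begin

text \<open>
  Why the values converge. Take any admissible strategy \<open>(L1, L2)\<close> and modify it only after the
  \<open>n\<close>-th claim time \<open>\<tau>\<^sub>n\<close>: from then on take the money and run (\<open>run1\<close>, \<open>run2\<close>). On a path that is
  ruined by time \<open>\<tau>\<^sub>n\<close> nothing has changed, so the payoff is the same. On a path that survives \<open>\<tau>\<^sub>n\<close>
  the modified strategy has earned at least the dividends that \<open>(L1, L2)\<close> pays before \<open>\<tau>\<^sub>n\<close>. Since
  only finitely many claims arrive in bounded time, \<open>\<tau>\<^sub>n\<close> tends to infinity. Hence every path that
  is ever ruined is eventually of the first kind, and on a path that is never ruined the dividends
  before \<open>\<tau>\<^sub>n\<close> increase to its whole payoff. Monotone convergence then gives
  \<open>strategy_value x y L1 L2 \<le> (SUP n. optimal_value_n n x y)\<close>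
  (\<open>strategy_value_le_SUP_optimal_value_n\<close>), and \<open>optimal_value_n n x y\<close> never exceeds
  \<open>optimal_value x y\<close>. All payments are nonnegative, so the argument covers infinite
  values as well.

  Why the values increase. A strategy that runs after claim \<open>m\<close> has total surplus \<open>0\<close> from then on,
  so it is ruined by the next claim. If it survives claim \<open>n \<ge> m\<close>, then claims \<open>m\<close> and \<open>n\<close> arrive
  simultaneously, and it runs after claim \<open>n\<close> as well (\<open>strategies_n_mono\<close>).

  Two technical points carry the weight.

  Discounted dividends. Fubini's theorem turns the Stieltjes integral into an ordinary integral of
  the dividend path (\<open>discounted_dividends_eq\<close>):
  \<open>\<integral>\<^bsub>[0,T)\<^esub> exp (- \<delta> s) dl\<^sub>s = \<integral>\<^bsub>r \<ge> 0\<^esub> \<delta> exp (- \<delta> r) l (min r T) dr\<close>.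
  From this form one reads off that the left side depends only on the path up to \<open>T\<close>, grows with
  \<open>T\<close>, converges as \<open>T\<close> tends to infinity, and is measurable in the path.

  Predictability of the modified strategy. It is left-continuous, so it suffices that it is adapted
  to the filtration of the two surplus processes. Its value at time \<open>t\<close> involves \<open>\<tau>\<^sub>n\<close>, the dividends
  and surpluses at \<open>\<tau>\<^sub>n\<close>, and the transfers settled by then. The claim counts are recovered from the
  surpluses, since every claim has positive size (\<open>count_observable\<close>); processes with one-sided
  continuous paths can be sampled at the random time \<open>min \<tau>\<^sub>n t\<close> by discretising it from the correct
  side; and the transfers follow by recursion over the claims (\<open>settled_transfers_info\<close>).
\<close>

section \<open>Discounted dividends as an integral over the path\<close>

lemma emeasure_interval_measure_Ioo:
  assumes "a < b" and mono_F: "\<And>x y. x \<le> y \<Longrightarrow> F x \<le> F y"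
    and right_cont_F: "\<And>a. continuous (at_right a) F"
    and lim: "(F \<longlongrightarrow> c) (at_left b)"
  shows "emeasure (interval_measure F) {a<..<b} = ennreal (c - F a)"
proof (rule tendsto_unique)
  show "((\<lambda>s. ennreal (F s - F a)) \<longlongrightarrow> emeasure (interval_measure F) {a<..<b}) (at_left b)"
  proof (rule tendsto_at_left_sequentially)
    fix s :: "nat \<Rightarrow> real"
    assume s: "\<And>n. s n < b" "\<And>n. a < s n" "incseq s" "s \<longlonglongrightarrow> b"
    have "(\<lambda>n. emeasure (interval_measure F) {a<..s n})
        \<longlonglongrightarrow> emeasure (interval_measure F) (\<Union>n. {a<..s n})"
      using s(3) by (intro Lim_emeasure_incseq) (force simp: incseq_def)+
    moreover have "(\<Union>n. {a<..s n}) = {a<..<b}"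
    proof -
      have "\<exists>n. x \<le> s n" if "x < b" for x
        using order_tendstoD(1)[OF s(4) that]
        by (auto simp: eventually_sequentially intro: less_imp_le)
      then show ?thesis
        using s(1) by (fastforce intro: le_less_trans)
    qed
    moreover have "emeasure (interval_measure F) {a<..s n} = ennreal (F (s n) - F a)" for n
      using less_imp_le[OF s(2)] mono_F right_cont_F by (rule emeasure_interval_measure_Ioc)
    ultimately show "(\<lambda>n. ennreal (F (s n) - F a)) \<longlonglongrightarrow> emeasure (interval_measure F) {a<..<b}"
      by simp
  qed fact
  show "((\<lambda>s. ennreal (F s - F a)) \<longlongrightarrow> ennreal (c - F a)) (at_left b)"
    by (intro tendsto_ennrealI tendsto_intros lim)
qed simp

text \<open>The conditions that \<^const>\<open>dividend_process\<close> imposes on a single path, isolated so that the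
  Stieltjes integral can be studied path by path.\<close>

definition dividend_path :: "(real \<Rightarrow> real) \<Rightarrow> bool" where
  "dividend_path l \<longleftrightarrow> l 0 = 0 \<and> mono_on {0..} l \<and> (\<forall>t>0. continuous (at_left t) l) \<and>
     (\<forall>t\<ge>0. \<exists>c. (l \<longlongrightarrow> c) (at_right t))"

lemma dividend_pathD:
  assumes "dividend_path l"
  shows "l 0 = 0" and "0 \<le> s \<Longrightarrow> s \<le> t \<Longrightarrow> l s \<le> l t" and "0 \<le> t \<Longrightarrow> 0 \<le> l t"
    and "0 < t \<Longrightarrow> (l \<longlongrightarrow> l t) (at_left t)"
    and "0 \<le> t \<Longrightarrow> (l \<longlongrightarrow> Lim (at_right t) l) (at_right t)"
proof -
  show 0: "l 0 = 0" and mono: "0 \<le> s \<Longrightarrow> s \<le> t \<Longrightarrow> l s \<le> l t" for s t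
    using assms by (auto simp: dividend_path_def mono_on_def)
  show "0 \<le> t \<Longrightarrow> 0 \<le> l t"
    using mono[of 0 t] 0 by simp
  show "0 < t \<Longrightarrow> (l \<longlongrightarrow> l t) (at_left t)"
    using assms by (auto simp: dividend_path_def continuous_within)
  show "(l \<longlongrightarrow> Lim (at_right t) l) (at_right t)" if "0 \<le> t"
  proof -
    obtain c where c: "(l \<longlongrightarrow> c) (at_right t)"
      using assms \<open>0 \<le> t\<close> by (auto simp: dividend_path_def)
    moreover have "Lim (at_right t) l = c"
      by (rule tendsto_Lim) (simp_all add: c)
    ultimately show ?thesis by simp
  qed
qed

context
  fixes l :: "real \<Rightarrow> real" and F :: "real \<Rightarrow> real"
  assumes l: "dividend_path l"
  defines "F \<equiv> \<lambda>t. if t < 0 then 0 else Lim (at_right t) l"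
begin

lemma path_le_right_limit:
  assumes "0 \<le> t" shows "l t \<le> F t"
proof -
  have "\<forall>\<^sub>F u in at_right t. l t \<le> l u"
    using eventually_at_right_less[of t]
    by eventually_elim (use dividend_pathD(2)[OF l assms] in simp)
  with dividend_pathD(5)[OF l assms] have "l t \<le> Lim (at_right t) l"
    by (rule tendsto_lowerbound) simp
  then show ?thesis
    using assms by (simp add: F_def)
qed

lemma right_limit_le_path: "0 \<le> s \<Longrightarrow> s < t \<Longrightarrow> F s \<le> l t"
proof -
  assume st: "0 \<le> s" "s < t"
  have "\<forall>\<^sub>F u in at_right s. l u \<le> l t"
    using st dividend_pathD(2)[OF l] by (auto simp: eventually_at_right_field intro!: exI[of _ t])
  then show ?thesis
    using st dividend_pathD(5)[OF l, of s] by (auto simp: F_def intro!: tendsto_upperbound)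
qed

lemma right_limit_mono: "s \<le> t \<Longrightarrow> F s \<le> F t"
proof -
  assume "s \<le> t"
  consider "s = t" | "s < 0" "t < 0" | "s < 0" "0 \<le> t" | "0 \<le> s" "s < t"
    using \<open>s \<le> t\<close> by linarith
  then show ?thesis
  proof cases
    case 3
    then have "0 \<le> F t"
      using path_le_right_limit[of t] dividend_pathD(3)[OF l, of t] by simp
    then show ?thesis using 3 by (simp add: F_def)
  next
    case 4
    then show ?thesis
      using right_limit_le_path[of s t] path_le_right_limit[of t] by simp
  qed (simp_all add: F_def)
qed

lemma right_limit_right_continuous: "continuous (at_right a) F"
proof (cases "a < 0")
  case True
  have "\<forall>\<^sub>F s in at_right a. F s = F a"
    using True unfolding eventually_at_right_field by (intro exI[of _ 0]) (simp add: F_def)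
  then show ?thesis
    unfolding continuous_within by (rule tendsto_eventually)
next
  case False
  show ?thesis
    unfolding continuous_within
  proof (rule order_tendstoI)
    fix c assume "c < F a"
    show "\<forall>\<^sub>F s in at_right a. c < F s"
      using right_limit_mono[of a] \<open>c < F a\<close>
      by (intro eventually_mono[OF eventually_at_right_less]) (meson less_imp_le less_le_trans)
  next
    fix c assume "F a < c"
    then have "\<forall>\<^sub>F s in at_right a. l s < c"
      using dividend_pathD(5)[OF l, of a] False by (auto simp: F_def intro: order_tendstoD)
    then obtain b where b: "a < b" "\<And>s. a < s \<Longrightarrow> s < b \<Longrightarrow> l s < c"
      by (auto simp: eventually_at_right_field)
    have "F s < c" if "a < s" "s < b" for s
    proof -
      obtain u where "s < u" "u < b" using dense[OF \<open>s < b\<close>] by auto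
      then show ?thesis
        using right_limit_le_path[of s u] b(2)[of u] that False by simp
    qed
    then show "\<forall>\<^sub>F s in at_right a. F s < c"
      using b(1) by (auto simp: eventually_at_right_field)
  qed
qed

lemma right_limit_left_limit:
  assumes "0 < b" shows "(F \<longlongrightarrow> l b) (at_left b)"
proof (rule tendsto_sandwich)
  show "(l \<longlongrightarrow> l b) (at_left b)" using dividend_pathD(4)[OF l] assms by simp
  have pos: "\<forall>\<^sub>F s in at_left b. 0 < s \<and> s < b"
    using assms by (auto simp: eventually_at_left_field)
  show "\<forall>\<^sub>F s in at_left b. l s \<le> F s"
    using pos by eventually_elim (simp add: path_le_right_limit)
  show "\<forall>\<^sub>F s in at_left b. F s \<le> l b"
    using pos by eventually_elim (simp add: right_limit_le_path)
qed simp

text \<open>The half-open interval is what makes left-continuous paths convenient: the atom at \<open>b\<close>, paid right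
  after time \<open>b\<close>, is excluded, so the mass is exactly \<open>l b\<close>, while the atom at \<open>0\<close> is included.\<close>

lemma emeasure_dividends_Ico:
  assumes "0 \<le> b"
  shows "emeasure (interval_measure F) {0..<b} = ennreal (l b)"
proof (cases "b = 0")
  case True
  then show ?thesis using dividend_pathD(1)[OF l] by simp
next
  case False
  \<comment> \<open>Time \<open>-1\<close> stands for any negative time, where \<open>F\<close> vanishes.\<close>
  have Ioo: "emeasure (interval_measure F) {-1<..<b} = ennreal c"
    if "-1 < b" "(F \<longlongrightarrow> c) (at_left b)" for b c
  proof -
    have "F (-1) = 0" by (simp add: F_def)
    with emeasure_interval_measure_Ioo[where F=F and a="-1" and b=b and c=c,
        OF that(1) right_limit_mono right_limit_right_continuous that(2)]
    show ?thesis by simp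
  qed
  have "\<forall>\<^sub>F s in at_left (0::real). F s = 0"
    unfolding eventually_at_left_field by (intro exI[of _ "-1"]) (simp add: F_def)
  then have neg: "emeasure (interval_measure F) {-1<..<0} = 0"
    using Ioo[of 0 0] by (simp add: tendsto_eventually)
  have "emeasure (interval_measure F) {0..<b}
      = emeasure (interval_measure F) ({-1<..<b} - {-1<..<0})"
    by (rule arg_cong[where f="emeasure _"]) auto
  also have "\<dots> = emeasure (interval_measure F) {-1<..<b} - emeasure (interval_measure F) {-1<..<0}"
    using False assms by (intro emeasure_Diff) (auto simp: neg)
  also have "\<dots> = ennreal (l b)"
    using Ioo[OF _ right_limit_left_limit, of b] False assms neg by simp
  finally show ?thesis .
qed

text \<open>Write \<open>exp (- \<delta> s)\<close> as the integral of \<open>\<delta> exp (- \<delta> r)\<close> over \<open>r > s\<close> and exchange the order of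
  integration: the inner integral becomes the mass of \<open>[0, min r T)\<close>, which is \<open>l (min r T)\<close>.\<close>

lemma discounted_dividends_eq_half_line:
  assumes "0 < \<delta>" and T: "0 \<le> T"
  shows "discounted_dividends \<delta> l T =
    (\<integral>\<^sup>+ r\<in>{0..}. ennreal (\<delta> * exp (- \<delta> * r)) * ennreal (l (real_of_ereal (min (ereal r) T))) \<partial>lborel)"
proof -
  interpret F: sigma_finite_measure "interval_measure F"
    by (rule sigma_finite_interval_measure[OF right_limit_mono right_limit_right_continuous])
  interpret pair_sigma_finite lborel "interval_measure F" ..
  define B where "B = {s. 0 \<le> s \<and> ereal s < T}"
  have [measurable]: "B \<in> sets borel"
    unfolding B_def by measurable
  \<comment> \<open>The strict inequality \<open>s < r\<close> yields the half-open interval \<open>[0, min r T)\<close> for every \<open>r\<close>, atoms included.\<close>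
  define k where "k = (\<lambda>r s. ennreal (\<delta> * exp (- \<delta> * r)) * indicator B s * indicator {s<..} r)"
  have k[measurable]: "case_prod k \<in> borel_measurable (lborel \<Otimes>\<^sub>M interval_measure F)"
  proof -
    have "k = (\<lambda>r s. if s \<in> B \<and> s < r then ennreal (\<delta> * exp (- \<delta> * r)) else 0)"
      by (auto simp: k_def fun_eq_iff indicator_def)
    then show ?thesis by simp
  qed
  have exp_tail: "(\<integral>\<^sup>+ r. ennreal (\<delta> * exp (- \<delta> * r)) * indicator {s<..} r \<partial>lborel) = ennreal (exp (- \<delta> * s))"
    for s
  proof -
    have "(\<integral>\<^sup>+ r. ennreal (\<delta> * exp (- \<delta> * r)) * indicator {s<..} r \<partial>lborel)
        = (\<integral>\<^sup>+ r. ennreal (\<delta> * exp (- \<delta> * r)) * indicator {s..} r \<partial>lborel)"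
      by (rule nn_integral_cong_AE, use AE_lborel_singleton[of s] in eventually_elim)
        (simp add: indicator_def)
    moreover
    have "(\<integral>\<^sup>+ r. ennreal (\<delta> * exp (- \<delta> * r)) * indicator {s..} r \<partial>lborel)
        = ennreal (0 - (- exp (- \<delta> * s)))"
    proof (rule nn_integral_FTC_atLeast[where F="\<lambda>r. - exp (- \<delta> * r)"])
      show "((\<lambda>r. - exp (- \<delta> * r)) \<longlongrightarrow> 0) at_top"
      proof -
        have "filterlim (\<lambda>r. - (\<delta> * r)) at_bot at_top"
          unfolding filterlim_uminus_at_bot[symmetric]
          using \<open>0 < \<delta>\<close> by (simp add: filterlim_tendsto_pos_mult_at_top[OF tendsto_const _ filterlim_ident] filterlim_uminus_at_bot)
        from tendsto_minus[OF filterlim_compose[OF exp_at_bot this]] show ?thesis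
          by simp
      qed
    qed (use \<open>0 < \<delta>\<close> in \<open>auto intro!: derivative_eq_intros\<close>)
    ultimately show ?thesis by simp
  qed
  have "discounted_dividends \<delta> l T = (\<integral>\<^sup>+ s. ennreal (exp (- \<delta> * s)) * indicator B s \<partial>interval_measure F)"
    by (simp add: discounted_dividends_def F_def B_def)
  also have "\<dots> = (\<integral>\<^sup>+ s. (\<integral>\<^sup>+ r. k r s \<partial>lborel) \<partial>interval_measure F)"
  proof (rule nn_integral_cong)
    fix s
    have "k r s = indicator B s * (ennreal (\<delta> * exp (- \<delta> * r)) * indicator {s<..} r)" for r
      by (simp add: k_def mult_ac)
    then show "ennreal (exp (- \<delta> * s)) * indicator B s = (\<integral>\<^sup>+ r. k r s \<partial>lborel)"
      using exp_tail[of s] by (simp add: nn_integral_cmult mult.commute[of _ "indicator B s"])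
  qed
  also have "\<dots> = (\<integral>\<^sup>+ r. (\<integral>\<^sup>+ s. k r s \<partial>interval_measure F) \<partial>lborel)"
    by (rule Fubini') (rule k)
  also have "\<dots> = (\<integral>\<^sup>+ r\<in>{0..}. ennreal (\<delta> * exp (- \<delta> * r)) * ennreal (l (real_of_ereal (min (ereal r) T))) \<partial>lborel)"
  proof (rule nn_integral_cong)
    fix r :: real
    show "(\<integral>\<^sup>+ s. k r s \<partial>interval_measure F)
        = ennreal (\<delta> * exp (- \<delta> * r)) * ennreal (l (real_of_ereal (min (ereal r) T))) * indicator {0..} r"
    proof (cases "0 \<le> r")
      case True
      define b where "b = real_of_ereal (min (ereal r) T)"
      have b: "0 \<le> b" "ereal b = min (ereal r) T"
        using True T by (cases T; auto simp: b_def min_def)+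
      have "k r s = ennreal (\<delta> * exp (- \<delta> * r)) * indicator {0..<b} s" for s
      proof -
        have "s < b \<longleftrightarrow> s < r \<and> ereal s < T"
          using min_less_iff_conj[of "ereal s" "ereal r" T] unfolding b(2)[symmetric] by simp
        then have "s \<in> B \<and> s < r \<longleftrightarrow> s \<in> {0..<b}"
          unfolding B_def mem_Collect_eq atLeastLessThan_iff by blast
        then show ?thesis by (cases "s \<in> {0..<b}") (auto simp: k_def indicator_def)
      qed
      then show ?thesis
        using True emeasure_dividends_Ico[OF b(1)] by (simp add: nn_integral_cmult_indicator b_def)
    next
      case False
      then have "k r s = 0" for s
        by (simp add: k_def B_def indicator_def)
      then show ?thesis using False by simp
    qed
  qed
  finally show ?thesis .
qed

end

text \<open>The time \<open>min r T\<close> as a real number; it is \<open>0\<close> for negative \<open>r\<close>, where \<open>l 0 = 0\<close> makes the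
  integrand below vanish, so that the integral can extend over the whole line.\<close>

definition time_cap :: "ereal \<Rightarrow> real \<Rightarrow> real" where
  "time_cap T r = real_of_ereal (max 0 (min (ereal r) T))"

lemma ereal_time_cap: "0 \<le> T \<Longrightarrow> ereal (time_cap T r) = max 0 (min (ereal r) T)"
  by (cases T) (auto simp: time_cap_def max_def min_def zero_ereal_def)

lemma time_cap_bounds: "0 \<le> T \<Longrightarrow> 0 \<le> time_cap T r" "0 \<le> T \<Longrightarrow> ereal (time_cap T r) \<le> T"
  by (simp_all add: ereal_time_cap flip: ereal_less_eq(5))

lemma time_cap_mono:
  assumes "0 \<le> S" "S \<le> T" shows "time_cap S r \<le> time_cap T r"
proof -
  have "max 0 (min (ereal r) S) \<le> max 0 (min (ereal r) T)"
    using assms by (intro max.mono min.mono) auto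
  then show ?thesis
    using assms by (simp add: ereal_time_cap[symmetric] order_trans[OF assms])
qed

lemma time_cap_eq: "0 \<le> T \<Longrightarrow> ereal r \<le> T \<Longrightarrow> time_cap T r = max 0 r"
  by (auto simp: time_cap_def max_def zero_ereal_def min_def)

lemma discounted_dividends_eq:
  assumes l: "dividend_path l" and "0 < \<delta>" and T: "0 \<le> T"
  shows "discounted_dividends \<delta> l T =
    (\<integral>\<^sup>+ r. ennreal (\<delta> * exp (- \<delta> * r)) * ennreal (l (time_cap T r)) \<partial>lborel)"
  unfolding discounted_dividends_eq_half_line[OF assms]
proof (rule nn_integral_cong)
  fix r :: real
  have "time_cap T r = real_of_ereal (min (ereal r) T)" if "0 \<le> r"
    using that T by (simp add: time_cap_def max_def)
  moreover have "time_cap T r = 0" if "r < 0"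
  proof -
    have "ereal r \<le> T"
      using that T by (intro order_trans[OF _ T]) simp
    then show ?thesis
      using that T by (simp add: time_cap_eq)
  qed
  ultimately show "ennreal (\<delta> * exp (- \<delta> * r)) * ennreal (l (real_of_ereal (min (ereal r) T))) * indicator {0..} r
      = ennreal (\<delta> * exp (- \<delta> * r)) * ennreal (l (time_cap T r))"
    using dividend_pathD(1)[OF l] by (cases "0 \<le> r") simp_all
qed

lemma discounted_dividends_cong:
  assumes "dividend_path l" "dividend_path l'" "0 < \<delta>" "0 \<le> T"
    and "\<And>s. 0 \<le> s \<Longrightarrow> ereal s \<le> T \<Longrightarrow> l s = l' s"
  shows "discounted_dividends \<delta> l T = discounted_dividends \<delta> l' T"
  using assms by (simp add: discounted_dividends_eq time_cap_bounds)

lemma discounted_dividends_mono: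
  assumes "dividend_path l" "0 < \<delta>" "0 \<le> S" "S \<le> T"
  shows "discounted_dividends \<delta> l S \<le> discounted_dividends \<delta> l T"
  unfolding discounted_dividends_eq[OF assms(1-3)] discounted_dividends_eq[OF assms(1,2) order_trans[OF assms(3,4)]]
  using dividend_pathD(2)[OF assms(1) time_cap_bounds(1)[OF assms(3)] time_cap_mono[OF assms(3,4)]]
  by (intro nn_integral_mono mult_left_mono ennreal_leI) auto

section \<open>Sampling processes at random times\<close>

text \<open>For \<open>t > 0\<close> the last point strictly before \<open>t\<close>, and the first point strictly after \<open>t\<close>, of the grid of mesh
  \<open>1 / Suc m\<close>. Strictness matters: one-sided limits say nothing about the value at the point itself.\<close>

definition left_grid :: "nat \<Rightarrow> real \<Rightarrow> real" where
  "left_grid m t = max 0 ((of_int \<lceil>real (Suc m) * t\<rceil> - 1) / real (Suc m))"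

definition right_grid :: "nat \<Rightarrow> real \<Rightarrow> real" where
  "right_grid m t = (of_int \<lfloor>real (Suc m) * t\<rfloor> + 1) / real (Suc m)"

lemma left_grid_bounds:
  assumes "0 < t"
  shows "0 \<le> left_grid m t" "left_grid m t < t" "t - 1 / real (Suc m) \<le> left_grid m t"
proof -
  have "of_int \<lceil>real (Suc m) * t\<rceil> - 1 < real (Suc m) * t" "real (Suc m) * t \<le> of_int \<lceil>real (Suc m) * t\<rceil>"
    by linarith+
  then have "(of_int \<lceil>real (Suc m) * t\<rceil> - 1) / real (Suc m) < t"
      "t - 1 / real (Suc m) \<le> (of_int \<lceil>real (Suc m) * t\<rceil> - 1) / real (Suc m)"
    by (simp_all add: field_simps del: of_nat_Suc)
  with assms show "0 \<le> left_grid m t" "left_grid m t < t" "t - 1 / real (Suc m) \<le> left_grid m t"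
    unfolding left_grid_def by linarith+
qed

lemma right_grid_bounds: "t < right_grid m t" "right_grid m t \<le> t + 1 / real (Suc m)"
proof -
  have "real (Suc m) * t < of_int \<lfloor>real (Suc m) * t\<rfloor> + 1" "of_int \<lfloor>real (Suc m) * t\<rfloor> \<le> real (Suc m) * t"
    by linarith+
  then show "t < right_grid m t" "right_grid m t \<le> t + 1 / real (Suc m)"
    by (simp_all add: right_grid_def field_simps del: of_nat_Suc)
qed

lemma filterlim_left_grid:
  assumes "0 < t" shows "filterlim (\<lambda>m. left_grid m t) (at_left t) sequentially"
proof -
  have "(\<lambda>m. left_grid m t) \<longlonglongrightarrow> t"
  proof (rule tendsto_sandwich[where f="\<lambda>m. t - 1 / real (Suc m)" and h="\<lambda>m. t"])
    show "(\<lambda>m. t - 1 / real (Suc m)) \<longlonglongrightarrow> t"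
      using tendsto_diff[OF tendsto_const LIMSEQ_inverse_real_of_nat, of t] by (simp add: inverse_eq_divide)
    show "\<forall>\<^sub>F m in sequentially. t - 1 / real (Suc m) \<le> left_grid m t"
      using left_grid_bounds(3)[OF assms] by (intro always_eventually allI)
    show "\<forall>\<^sub>F m in sequentially. left_grid m t \<le> t"
      using left_grid_bounds(2)[OF assms] by (intro always_eventually allI less_imp_le)
  qed simp
  then show ?thesis
    using left_grid_bounds(2)[OF assms] by (auto simp: filterlim_at less_imp_neq)
qed

lemma filterlim_right_grid:
  assumes "t < u" shows "filterlim (\<lambda>m. min u (right_grid m t)) (at_right t) sequentially"
proof -
  have "(\<lambda>m. right_grid m t) \<longlonglongrightarrow> t"
  proof (rule tendsto_sandwich[where f="\<lambda>m. t" and h="\<lambda>m. t + 1 / real (Suc m)"])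
    show "(\<lambda>m. t + 1 / real (Suc m)) \<longlonglongrightarrow> t"
      using tendsto_add[OF tendsto_const LIMSEQ_inverse_real_of_nat, of t] by (simp add: inverse_eq_divide)
    show "\<forall>\<^sub>F m in sequentially. right_grid m t \<le> t + 1 / real (Suc m)"
      using right_grid_bounds(2) by (intro always_eventually allI)
    show "\<forall>\<^sub>F m in sequentially. t \<le> right_grid m t"
      using right_grid_bounds(1) by (intro always_eventually allI less_imp_le)
  qed simp
  then have "(\<lambda>m. min u (right_grid m t)) \<longlonglongrightarrow> min u t"
    by (intro tendsto_intros)
  moreover have "t < min u (right_grid m t)" for m
    using assms right_grid_bounds(1)[of t m] by simp
  ultimately show ?thesis
    using assms by (simp add: filterlim_at less_imp_neq[THEN not_sym] min_absorb2)
qed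

text \<open>A random time rounded down to a grid takes countably many values, so evaluating there is measurable;
  left-continuity passes to the limit. Only values of \<open>f\<close> at times up to \<open>\<sigma>\<close> enter, which is
  why measurability is required on \<open>I\<close> only: with \<open>I = {..t}\<close> the lemma applies to the information
  available at time \<open>t\<close>.\<close>

lemma measurable_eval_left_continuous:
  fixes f :: "real \<Rightarrow> 'a \<Rightarrow> real"
  assumes \<sigma>[measurable]: "\<sigma> \<in> borel_measurable G"
    and range: "\<And>\<omega>. \<omega> \<in> space G \<Longrightarrow> 0 \<le> \<sigma> \<omega> \<and> \<sigma> \<omega> \<in> I"
    and down: "\<And>q s. 0 \<le> q \<Longrightarrow> q \<le> s \<Longrightarrow> s \<in> I \<Longrightarrow> q \<in> I"
    and f: "\<And>q. 0 \<le> q \<Longrightarrow> q \<in> I \<Longrightarrow> f q \<in> borel_measurable G"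
    and left: "\<And>\<omega> s. \<omega> \<in> space G \<Longrightarrow> 0 < s \<Longrightarrow> ((\<lambda>q. f q \<omega>) \<longlongrightarrow> f s \<omega>) (at_left s)"
  shows "(\<lambda>\<omega>. f (\<sigma> \<omega>) \<omega>) \<in> borel_measurable G"
proof (rule borel_measurable_LIMSEQ_metric)
  define h where "h = (\<lambda>q \<omega>. if 0 \<le> q \<and> q \<in> I then f q \<omega> else 0)"
  have h: "h q \<in> borel_measurable G" for q
    using f[of q] by (cases "0 \<le> q \<and> q \<in> I") (auto simp: h_def)
  show "(\<lambda>\<omega>. h (left_grid m (\<sigma> \<omega>)) \<omega>) \<in> borel_measurable G" for m
    unfolding left_grid_def
    by (rule measurable_compose_countable[where f="\<lambda>k \<omega>. h (max 0 ((of_int k - 1) / real (Suc m))) \<omega>"])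
      (use h in \<open>simp_all\<close>)
  fix \<omega> assume \<omega>: "\<omega> \<in> space G"
  show "(\<lambda>m. h (left_grid m (\<sigma> \<omega>)) \<omega>) \<longlonglongrightarrow> f (\<sigma> \<omega>) \<omega>"
  proof (cases "\<sigma> \<omega> = 0")
    case True
    then show ?thesis
      using range[OF \<omega>] by (simp add: left_grid_def h_def)
  next
    case False
    then have pos: "0 < \<sigma> \<omega>" using range[OF \<omega>] by simp
    have "h (left_grid m (\<sigma> \<omega>)) \<omega> = f (left_grid m (\<sigma> \<omega>)) \<omega>" for m
      using left_grid_bounds[OF pos, of m] down[of "left_grid m (\<sigma> \<omega>)" "\<sigma> \<omega>"] range[OF \<omega>]
      by (simp add: h_def)
    then show ?thesis
      using filterlim_compose[OF left[OF \<omega> pos] filterlim_left_grid[OF pos]] by simp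
  qed
qed

text \<open>The mirror image rounds up, capped at \<open>u\<close> so that the process is never consulted after time \<open>u\<close>.\<close>

lemma measurable_eval_right_continuous:
  fixes f :: "real \<Rightarrow> 'a \<Rightarrow> real"
  assumes \<sigma>[measurable]: "\<sigma> \<in> borel_measurable G"
    and range: "\<And>\<omega>. \<omega> \<in> space G \<Longrightarrow> 0 \<le> \<sigma> \<omega> \<and> \<sigma> \<omega> \<le> u"
    and f: "\<And>q. 0 \<le> q \<Longrightarrow> q \<le> u \<Longrightarrow> f q \<in> borel_measurable G"
    and right: "\<And>\<omega> s. \<omega> \<in> space G \<Longrightarrow> 0 \<le> s \<Longrightarrow> ((\<lambda>q. f q \<omega>) \<longlongrightarrow> f s \<omega>) (at_right s)"
  shows "(\<lambda>\<omega>. f (\<sigma> \<omega>) \<omega>) \<in> borel_measurable G"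
proof (rule borel_measurable_LIMSEQ_metric)
  define h where "h = (\<lambda>q \<omega>. if 0 \<le> q \<and> q \<le> u then f q \<omega> else 0)"
  have h: "h q \<in> borel_measurable G" for q
    using f[of q] by (cases "0 \<le> q \<and> q \<le> u") (auto simp: h_def)
  show "(\<lambda>\<omega>. h (min u (right_grid m (\<sigma> \<omega>))) \<omega>) \<in> borel_measurable G" for m
    unfolding right_grid_def
    by (rule measurable_compose_countable[where f="\<lambda>k \<omega>. h (min u ((of_int k + 1) / real (Suc m))) \<omega>"])
      (use h in \<open>simp_all\<close>)
  fix \<omega> assume \<omega>: "\<omega> \<in> space G"
  have "0 \<le> min u (right_grid m (\<sigma> \<omega>))" for m
    using right_grid_bounds(1)[of "\<sigma> \<omega>" m] range[OF \<omega>] by simp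
  then have h_eq: "h (min u (right_grid m (\<sigma> \<omega>))) \<omega> = f (min u (right_grid m (\<sigma> \<omega>))) \<omega>" for m
    by (simp add: h_def)
  show "(\<lambda>m. h (min u (right_grid m (\<sigma> \<omega>))) \<omega>) \<longlonglongrightarrow> f (\<sigma> \<omega>) \<omega>"
  proof (cases "\<sigma> \<omega> = u")
    case True
    then have "h u \<omega> = f u \<omega>" using range[OF \<omega>] by (simp add: h_def)
    then show ?thesis
      using right_grid_bounds(1)[of u] True by (simp add: min_absorb1 less_imp_le)
  next
    case False
    then have "\<sigma> \<omega> < u" using range[OF \<omega>] by simp
    from filterlim_compose[OF right[OF \<omega>] filterlim_right_grid[OF this]] show ?thesis
      using range[OF \<omega>] by (simp add: h_eq)
  qed
qed

section \<open>Predictable processes and natural filtrations\<close>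

context
  fixes \<Omega> :: "'a set" and F :: "real \<Rightarrow> 'a measure"
  assumes filtration: "filtration \<Omega> F"
begin

interpretation filtration \<Omega> F
  by (rule filtration)

lemma predictable_rectangles:
  "{{0} \<times> A | A. A \<in> sets (F 0)} \<union> {{s<..t} \<times> A | s t A. 0 \<le> s \<and> s < t \<and> A \<in> sets (F s)}
    \<subseteq> Pow ({0..} \<times> space (F 0))"
proof -
  have "J \<times> A \<subseteq> {0..} \<times> space (F 0)" if "A \<in> sets (F s)" "J \<subseteq> {0..}" for J :: "real set" and A s
    using sets.sets_into_space[OF that(1)] that(2) by (auto simp: space_F)
  note sub = this
  have "{s<..t} \<subseteq> {0..}" if "0 \<le> s" for s t :: real
    using that by auto
  with sub show ?thesis by blast
qed

text \<open>Sections at time \<open>t\<close> of the generating rectangles belong to \<open>F t\<close>.\<close>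

lemma predictable_adapted:
  assumes "predictable F L" and "0 \<le> t"
  shows "L t \<in> borel_measurable (F t)"
proof -
  have "(\<lambda>\<omega>. (t, \<omega>)) \<in> measurable (F t) (predictable_sigma F)"
    unfolding predictable_sigma_def
  proof (rule measurable_measure_of)
    show "{{0} \<times> A | A. A \<in> sets (F 0)} \<union> {{s<..t} \<times> A | s t A. 0 \<le> s \<and> s < t \<and> A \<in> sets (F s)}
        \<subseteq> Pow ({0..} \<times> space (F 0))"
      by (rule predictable_rectangles)
    show "(\<lambda>\<omega>. (t, \<omega>)) \<in> space (F t) \<rightarrow> {0..} \<times> space (F 0)"
      using assms(2) by (simp add: space_F)
    have "(\<lambda>\<omega>. (t, \<omega>)) -` (J \<times> A) \<inter> space (F t) \<in> sets (F t)"
      if "A \<in> sets (F s)" "t \<in> J \<longrightarrow> s \<le> t" for J A s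
    proof (cases "t \<in> J")
      case True
      with that have "A \<in> sets (F t)" using sets_F_mono[of s t] by auto
      moreover from True have "(\<lambda>\<omega>. (t, \<omega>)) -` (J \<times> A) = A" by auto
      ultimately show ?thesis by auto
    next
      case False
      then have "(\<lambda>\<omega>. (t, \<omega>)) -` (J \<times> A) = {}" by auto
      then show ?thesis by simp
    qed
    note sect = this
    fix y assume "y \<in> {{0} \<times> A | A. A \<in> sets (F 0)} \<union>
      {{s<..t} \<times> A | s t A. 0 \<le> s \<and> s < t \<and> A \<in> sets (F s)}"
    then consider A where "y = {0} \<times> A" "A \<in> sets (F 0)"
      | s r A where "y = {s<..r} \<times> A" "A \<in> sets (F s)" by blast
    then show "(\<lambda>\<omega>. (t, \<omega>)) -` y \<inter> space (F t) \<in> sets (F t)"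
    proof cases
      case 1
      then show ?thesis using sect[of A 0 "{0}"] by simp
    next
      case 2
      then show ?thesis using sect[of A s "{s<..r}"] by simp
    qed
  qed
  from measurable_compose[OF this, of "\<lambda>(t, \<omega>). L t \<omega>"] assms(1) show ?thesis
    by (simp add: predictable_def)
qed

text \<open>Freeze the process at the last grid point before \<open>t\<close>. Preimages under the frozen process are
  countable unions of predictable rectangles, and by left-continuity the frozen processes converge
  to the original one.\<close>

lemma left_continuous_adapted_predictable:
  assumes adapted: "\<And>t. 0 \<le> t \<Longrightarrow> L t \<in> borel_measurable (F t)"
    and left: "\<And>\<omega> t. \<omega> \<in> \<Omega> \<Longrightarrow> 0 < t \<Longrightarrow> ((\<lambda>s. L s \<omega>) \<longlongrightarrow> L t \<omega>) (at_left t)"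
  shows "predictable F L"
  unfolding predictable_def
proof (rule borel_measurable_LIMSEQ_metric)
  let ?P = "predictable_sigma F"
  note gen = predictable_rectangles
  have space_P: "space ?P = {0..} \<times> \<Omega>"
    unfolding predictable_sigma_def by (subst space_measure_of[OF gen]) (simp add: space_F)
  have sets_0: "{0} \<times> A \<in> sets ?P" if "A \<in> sets (F 0)" for A
    unfolding predictable_sigma_def using that by (intro in_measure_of[OF gen]) auto
  have sets_Ioc: "{s<..t} \<times> A \<in> sets ?P" if "A \<in> sets (F s)" "0 \<le> s" "s < t" for A s t
    unfolding predictable_sigma_def using that by (intro in_measure_of[OF gen]) auto
  show "(\<lambda>(t, \<omega>). L (left_grid m t) \<omega>) \<in> borel_measurable ?P" for m
  proof (rule measurableI)
    fix B :: "real set" assume B: "B \<in> sets borel"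
    define e where "e = (\<lambda>k. real k / real (Suc m))"
    have grid: "left_grid m t = e k" if "t \<in> {e k<..e (Suc k)}" for t k
    proof -
      have "real k < real (Suc m) * t" "real (Suc m) * t \<le> real k + 1"
        using that by (auto simp: e_def field_simps)
      then have "\<lceil>real (Suc m) * t\<rceil> = int k + 1"
        by (intro ceiling_unique) simp_all
      then show ?thesis by (simp add: left_grid_def e_def)
    qed
    have cover: "\<exists>k. t \<in> {e k<..e (Suc k)}" if "0 < t" for t
    proof -
      define k where "k = nat (\<lceil>real (Suc m) * t\<rceil> - 1)"
      have "0 < \<lceil>real (Suc m) * t\<rceil>" using that by simp
      then have "real k = of_int \<lceil>real (Suc m) * t\<rceil> - 1" by (simp add: k_def)
      then have "real k < real (Suc m) * t" "real (Suc m) * t \<le> real k + 1" by linarith+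
      then show ?thesis by (intro exI[of _ k]) (auto simp: e_def field_simps)
    qed
    have "(\<lambda>(t, \<omega>). L (left_grid m t) \<omega>) -` B \<inter> space ?P
        = {0} \<times> (L 0 -` B \<inter> space (F 0)) \<union> (\<Union>k. {e k<..e (Suc k)} \<times> (L (e k) -` B \<inter> space (F (e k))))"
      (is "?lhs = ?rhs")
    proof (intro set_eqI)
      fix z :: "real \<times> 'a"
      obtain t \<omega> where z: "z = (t, \<omega>)" by (cases z)
      have e0: "0 \<le> e k" for k by (simp add: e_def)
      consider "t < 0" | "t = 0" | k where "t \<in> {e k<..e (Suc k)}" using cover[of t] by fastforce
      then show "z \<in> ?lhs \<longleftrightarrow> z \<in> ?rhs"
      proof cases
        case 1
        then show ?thesis using e0 by (auto simp: z space_P space_F intro: less_le_trans dest: le_less_trans[OF e0])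
      next
        case 2
        then show ?thesis using e0 by (auto simp: z space_P space_F left_grid_def dest: le_less_trans[OF e0])
      next
        case 3
        have "0 < t" using 3 e0[of k] by simp
        have "e j = e k" if "t \<in> {e j<..e (Suc j)}" for j
          using grid[OF that] grid[OF 3] by simp
        note eq = this
        have "z \<in> ?rhs \<longleftrightarrow> (\<exists>j. t \<in> {e j<..e (Suc j)} \<and> \<omega> \<in> \<Omega> \<and> L (e j) \<omega> \<in> B)"
          using \<open>0 < t\<close> by (auto simp: z space_F)
        also have "\<dots> \<longleftrightarrow> \<omega> \<in> \<Omega> \<and> L (e k) \<omega> \<in> B"
          using 3 eq by metis
        finally have "z \<in> ?rhs \<longleftrightarrow> \<omega> \<in> \<Omega> \<and> L (e k) \<omega> \<in> B" .
        then show ?thesis using grid[OF 3] \<open>0 < t\<close> by (auto simp: z space_P)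
      qed
    qed
    also have "\<dots> \<in> sets ?P"
    proof (intro sets.Un sets.countable_UN image_subsetI)
      show "{0} \<times> (L 0 -` B \<inter> space (F 0)) \<in> sets ?P"
        by (intro sets_0 measurable_sets[OF adapted B]) simp
      show "{e k<..e (Suc k)} \<times> (L (e k) -` B \<inter> space (F (e k))) \<in> sets ?P" for k
        by (intro sets_Ioc measurable_sets[OF adapted B]) (simp_all add: e_def divide_strict_right_mono)
    qed
    finally show "(\<lambda>(t, \<omega>). L (left_grid m t) \<omega>) -` B \<inter> space ?P \<in> sets ?P" .
  qed simp
  fix z assume "z \<in> space ?P"
  then obtain t \<omega> where z: "z = (t, \<omega>)" "0 \<le> t" "\<omega> \<in> \<Omega>" by (auto simp: space_P)
  show "(\<lambda>m. case z of (t, \<omega>) \<Rightarrow> L (left_grid m t) \<omega>) \<longlonglongrightarrow> (case z of (t, \<omega>) \<Rightarrow> L t \<omega>)"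
  proof (cases "t = 0")
    case True
    then show ?thesis by (simp add: z left_grid_def)
  next
    case False
    then have "0 < t" using z by simp
    from filterlim_compose[OF left[OF z(3) this] filterlim_left_grid[OF this]] show ?thesis
      by (simp add: z)
  qed
qed

end

lemma space_natural_filtration [simp]: "space (natural_filtration M Z t) = space M"
  by (auto simp: natural_filtration_def generated_sigma_def intro!: space_measure_of)

lemma sets_natural_filtration:
  "sets (natural_filtration M Z t) = sigma_sets (space M) {Z i -` B \<inter> space M | i B. i \<in> {0..t} \<and> B \<in> sets borel}"
  unfolding natural_filtration_def generated_sigma_def by (rule sets_measure_of) auto

lemma filtration_natural: "filtration (space M) (natural_filtration M Z)"
proof
  fix s t :: real assume "s \<le> t"
  then show "sets (natural_filtration M Z s) \<subseteq> sets (natural_filtration M Z t)"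
    unfolding sets_natural_filtration by (intro sigma_sets_mono') fastforce
qed simp

lemma natural_filtration_adapted:
  fixes Z :: "real \<Rightarrow> 'a \<Rightarrow> 'b::topological_space"
  assumes "0 \<le> s" "s \<le> t" shows "Z s \<in> borel_measurable (natural_filtration M Z t)"
proof (rule measurableI)
  fix B :: "'b set" assume "B \<in> sets borel"
  then show "Z s -` B \<inter> space (natural_filtration M Z t) \<in> sets (natural_filtration M Z t)"
    using assms by (auto simp: sets_natural_filtration)
qed simp

lemma measurable_natural_filtration_le:
  assumes "\<And>s. 0 \<le> s \<Longrightarrow> Z s \<in> borel_measurable M" and "f \<in> measurable (natural_filtration M Z t) N"
  shows "f \<in> measurable M N"
proof (rule measurable_from_subalg[OF _ assms(2)])
  show "subalgebra M (natural_filtration M Z t)"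
    unfolding subalgebra_def sets_natural_filtration
    using assms(1) by (auto intro!: sets.sigma_sets_subset measurable_sets)
qed

section \<open>Measurability and limits of discounted dividends\<close>

text \<open>Evaluation of a left-continuous process at the random time \<open>time_cap (\<tau> \<omega>) r\<close>, with \<open>r\<close> regarded
  as part of the randomness.\<close>

lemma borel_measurable_dividends_until:
  fixes L :: "real \<Rightarrow> 'a \<Rightarrow> real"
  assumes L: "\<And>t. 0 \<le> t \<Longrightarrow> L t \<in> borel_measurable M"
    and path: "\<And>\<omega>. \<omega> \<in> space M \<Longrightarrow> dividend_path (\<lambda>t. L t \<omega>)"
    and \<tau>[measurable]: "\<tau> \<in> borel_measurable M" and nonneg: "\<And>\<omega>. \<omega> \<in> space M \<Longrightarrow> 0 \<le> \<tau> \<omega>"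
  shows "(\<lambda>(\<omega>, r). L (time_cap (\<tau> \<omega>) r) \<omega>) \<in> borel_measurable (M \<Otimes>\<^sub>M lborel)"
proof -
  have "(\<lambda>z. L (time_cap (\<tau> (fst z)) (snd z)) (fst z)) \<in> borel_measurable (M \<Otimes>\<^sub>M lborel)"
  proof (rule measurable_eval_left_continuous[where I=UNIV and f="\<lambda>q z. L q (fst z)"])
    show "(\<lambda>z. time_cap (\<tau> (fst z)) (snd z)) \<in> borel_measurable (M \<Otimes>\<^sub>M lborel)"
      unfolding time_cap_def by measurable
    show "(\<lambda>z. L q (fst z)) \<in> borel_measurable (M \<Otimes>\<^sub>M lborel)" if "0 \<le> q" for q
      using L[OF that] by measurable
    show "((\<lambda>q. L q (fst z)) \<longlongrightarrow> L s (fst z)) (at_left s)"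
      if "z \<in> space (M \<Otimes>\<^sub>M lborel)" "0 < s" for z :: "'a \<times> real" and s
      using dividend_pathD(4)[OF path that(2), of "fst z"] that(1) by (auto simp: space_pair_measure)
    show "0 \<le> time_cap (\<tau> (fst z)) (snd z) \<and> time_cap (\<tau> (fst z)) (snd z) \<in> UNIV"
      if "z \<in> space (M \<Otimes>\<^sub>M lborel)" for z
      using that nonneg[of "fst z"] by (auto simp: space_pair_measure time_cap_bounds)
  qed simp
  then show ?thesis by (simp add: case_prod_beta')
qed

lemma borel_measurable_discounted_dividends:
  fixes L :: "real \<Rightarrow> 'a \<Rightarrow> real"
  assumes L: "\<And>t. 0 \<le> t \<Longrightarrow> L t \<in> borel_measurable M"
    and path: "\<And>\<omega>. \<omega> \<in> space M \<Longrightarrow> dividend_path (\<lambda>t. L t \<omega>)"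
    and \<tau>: "\<tau> \<in> borel_measurable M" and nonneg: "\<And>\<omega>. \<omega> \<in> space M \<Longrightarrow> 0 \<le> \<tau> \<omega>"
    and "0 < \<delta>"
  shows "(\<lambda>\<omega>. discounted_dividends \<delta> (\<lambda>t. L t \<omega>) (\<tau> \<omega>)) \<in> borel_measurable M"
proof -
  note [measurable] = borel_measurable_dividends_until[OF L path \<tau> nonneg]
  have "(\<lambda>\<omega>. \<integral>\<^sup>+ r. ennreal (\<delta> * exp (- \<delta> * r)) * ennreal (L (time_cap (\<tau> \<omega>) r) \<omega>) \<partial>lborel)
      \<in> borel_measurable M"
    by measurable
  moreover have "discounted_dividends \<delta> (\<lambda>t. L t \<omega>) (\<tau> \<omega>)
      = (\<integral>\<^sup>+ r. ennreal (\<delta> * exp (- \<delta> * r)) * ennreal (L (time_cap (\<tau> \<omega>) r) \<omega>) \<partial>lborel)"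
    if "\<omega> \<in> space M" for \<omega>
    by (intro discounted_dividends_eq path nonneg that \<open>0 < \<delta>\<close>)
  ultimately show ?thesis
    by (simp cong: measurable_cong)
qed

text \<open>For fixed \<open>r\<close> the integrand in \<open>discounted_dividends_eq\<close> is increasing in the horizon and becomes
  constant once the horizon exceeds \<open>r\<close>.\<close>

lemma discounted_dividends_SUP:
  assumes l: "dividend_path l" and "0 < \<delta>" and T: "incseq T" "\<And>n. 0 \<le> T n"
    and unbounded: "\<And>r. \<exists>n. ereal r \<le> T n"
  shows "(SUP n. discounted_dividends \<delta> l (T n)) = discounted_dividends \<delta> l \<infinity>"
proof -
  have [measurable]: "(\<lambda>r. l (time_cap S r)) \<in> borel_measurable lborel" if "0 \<le> S" for S
    using borel_measurable_dividends_until[of "\<lambda>t _. l t" "count_space {()}" "\<lambda>_. S"] l that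
    by (auto dest: measurable_Pair2[of _ _ _ _ "()"])
  have mono: "l (time_cap (T m) r) \<le> l (time_cap (T n) r)" if "m \<le> n" for m n r
    using T that by (intro dividend_pathD(2)[OF l] time_cap_bounds time_cap_mono) (auto simp: incseq_def)
  have "(SUP n. ennreal (\<delta> * exp (- \<delta> * r)) * ennreal (l (time_cap (T n) r)))
      = ennreal (\<delta> * exp (- \<delta> * r)) * ennreal (l (time_cap \<infinity> r))" for r
  proof (rule antisym)
    have "l (time_cap (T n) r) \<le> l (time_cap \<infinity> r)" for n
      using T by (intro dividend_pathD(2)[OF l] time_cap_bounds time_cap_mono) auto
    then show "(SUP n. ennreal (\<delta> * exp (- \<delta> * r)) * ennreal (l (time_cap (T n) r)))
      \<le> ennreal (\<delta> * exp (- \<delta> * r)) * ennreal (l (time_cap \<infinity> r))"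
      by (intro SUP_least mult_left_mono ennreal_leI) auto
    obtain n where "ereal r \<le> T n" using unbounded by blast
    then have "time_cap \<infinity> r = time_cap (T n) r"
      using T(2) by (simp add: time_cap_eq)
    then show "ennreal (\<delta> * exp (- \<delta> * r)) * ennreal (l (time_cap \<infinity> r))
      \<le> (SUP n. ennreal (\<delta> * exp (- \<delta> * r)) * ennreal (l (time_cap (T n) r)))"
      by (auto intro: SUP_upper2[of n])
  qed
  note cap = this
  have "discounted_dividends \<delta> l \<infinity>
      = (\<integral>\<^sup>+ r. (SUP n. ennreal (\<delta> * exp (- \<delta> * r)) * ennreal (l (time_cap (T n) r))) \<partial>lborel)"
    unfolding cap using l \<open>0 < \<delta>\<close> by (rule discounted_dividends_eq) simp
  also have "\<dots> = (SUP n. \<integral>\<^sup>+ r. ennreal (\<delta> * exp (- \<delta> * r)) * ennreal (l (time_cap (T n) r)) \<partial>lborel)"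
  proof (rule nn_integral_monotone_convergence_SUP)
    show "incseq (\<lambda>n r. ennreal (\<delta> * exp (- \<delta> * r)) * ennreal (l (time_cap (T n) r)))"
      using mono by (auto simp: incseq_def le_fun_def intro!: mult_left_mono ennreal_leI)
  qed (use T(2) in measurable)
  also have "\<dots> = (SUP n. discounted_dividends \<delta> l (T n))"
    using discounted_dividends_eq[OF l \<open>0 < \<delta>\<close> T(2)] by simp
  finally show ?thesis ..
qed

section \<open>First times and the claims of a single company\<close>

lemma first_time_nonneg: "0 \<le> first_time P"
  unfolding first_time_def by (intro Inf_greatest) (auto simp: zero_ereal_def)

lemma first_time_le: "0 \<le> t \<Longrightarrow> P t \<Longrightarrow> first_time P \<le> ereal t"
  unfolding first_time_def by (intro Inf_lower) auto

lemma first_time_greatest: "(\<And>t. 0 \<le> t \<Longrightarrow> P t \<Longrightarrow> c \<le> ereal t) \<Longrightarrow> c \<le> first_time P"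
  unfolding first_time_def by (intro Inf_greatest) auto

lemma first_time_less_iff: "first_time P < c \<longleftrightarrow> (\<exists>t\<ge>0. P t \<and> ereal t < c)"
  unfolding first_time_def by (auto simp: Inf_less_iff)

lemma first_time_cong: "(\<And>t. 0 \<le> t \<Longrightarrow> P t \<longleftrightarrow> Q t) \<Longrightarrow> first_time P = first_time Q"
  unfolding first_time_def by (metis (lifting))

text \<open>Right-continuity ensures that the infimum is attained.\<close>

lemma first_time_count_le_iff:
  fixes g :: "real \<Rightarrow> nat"
  assumes mono: "\<And>s t. 0 \<le> s \<Longrightarrow> s \<le> t \<Longrightarrow> g s \<le> g t"
    and right: "\<And>t. 0 \<le> t \<Longrightarrow> \<forall>\<^sub>F s in at_right t. g s = g t"
    and "0 \<le> t"
  shows "first_time (\<lambda>s. n \<le> g s) \<le> ereal t \<longleftrightarrow> n \<le> g t"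
proof
  assume "n \<le> g t"
  with \<open>0 \<le> t\<close> show "first_time (\<lambda>s. n \<le> g s) \<le> ereal t" by (rule first_time_le)
next
  assume le: "first_time (\<lambda>s. n \<le> g s) \<le> ereal t"
  obtain b where b: "t < b" "\<And>s. t < s \<Longrightarrow> s < b \<Longrightarrow> g s = g t"
    using right[OF \<open>0 \<le> t\<close>] unfolding eventually_at_right_field by blast
  have "first_time (\<lambda>s. n \<le> g s) < ereal b"
    using le b(1) by (simp add: le_less_trans)
  then obtain s where s: "0 \<le> s" "n \<le> g s" "s < b"
    unfolding first_time_less_iff by auto
  show "n \<le> g t"
  proof (cases "s \<le> t")
    case True
    then show ?thesis using mono[OF s(1) True] s(2) by simp
  next
    case False
    then show ?thesis using b(2)[of s] s by simp
  qed
qed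

lemma dividend_process_iff:
  "dividend_process M \<F> L \<longleftrightarrow> predictable \<F> L \<and> (\<forall>\<omega>\<in>space M. dividend_path (\<lambda>t. L t \<omega>))"
  by (simp add: dividend_process_def dividend_path_def)

lemma (in prob_space) poisson_process_paths:
  assumes "poisson_process \<kappa> N" "\<omega> \<in> space M"
  shows "N 0 \<omega> = 0" "0 \<le> s \<Longrightarrow> s \<le> t \<Longrightarrow> N s \<omega> \<le> N t \<omega>"
    "0 \<le> t \<Longrightarrow> \<forall>\<^sub>F s in at_right t. N s \<omega> = N t \<omega>"
    "0 < t \<Longrightarrow> \<forall>\<^sub>F s in at_left t. N t \<omega> \<le> Suc (N s \<omega>)"
  using assms unfolding poisson_process_def by (auto simp: mono_on_def)

lemma (in prob_space) poisson_process_measurable: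
  assumes "poisson_process \<kappa> N" "0 \<le> t"
  shows "N t \<in> measurable M (count_space UNIV)"
  using assms unfolding poisson_process_def by auto

text \<open>The part of the model that concerns one company; both companies are instances.\<close>

locale claim_process = prob_space M
  for M :: "'w measure" and \<kappa> p :: real and N :: "real \<Rightarrow> 'w \<Rightarrow> nat" and U :: "nat \<Rightarrow> 'w \<Rightarrow> real" +
  assumes arrivals: "poisson_process \<kappa> N"
    and claims_measurable: "\<And>i. random_variable borel (U i)"
    and claims_pos: "\<And>i \<omega>. \<omega> \<in> space M \<Longrightarrow> 0 < U i \<omega>"
begin

lemmas paths = poisson_process_paths[OF arrivals]

lemma surplus_same_count:
  "N s \<omega> = N t \<omega> \<Longrightarrow> surplus p N U u t \<omega> = surplus p N U u s \<omega> + p * (t - s)"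
  by (simp add: surplus_def algebra_simps)

text \<open>Claims have positive size, so a claim is visible as a deviation of the surplus from the premium
  line. This is what makes claims observable from the surplus.\<close>

lemma surplus_after_claim:
  assumes "\<omega> \<in> space M" "N s \<omega> < N t \<omega>"
  shows "surplus p N U u t \<omega> < surplus p N U u s \<omega> + p * (t - s)"
proof -
  have "(\<Sum>i<N s \<omega>. U i \<omega>) < (\<Sum>i<N t \<omega>. U i \<omega>)"
    using assms claims_pos by (intro sum_strict_mono2[of _ _ "N s \<omega>"]) (auto intro: less_imp_le)
  then show ?thesis by (simp add: surplus_def algebra_simps)
qed

lemma surplus_increment_le:
  assumes "\<omega> \<in> space M" "0 \<le> s" "s \<le> t"
  shows "surplus p N U u t \<omega> \<le> surplus p N U u s \<omega> + p * (t - s)"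
  using surplus_after_claim[OF assms(1), of s t] surplus_same_count[of s \<omega> t] paths(2)[OF assms]
  by (cases "N s \<omega> = N t \<omega>") (auto simp: le_less)

lemma surplus_right_continuous:
  assumes "\<omega> \<in> space M" "0 \<le> t"
  shows "((\<lambda>s. surplus p N U u s \<omega>) \<longlongrightarrow> surplus p N U u t \<omega>) (at_right t)"
proof (rule Lim_transform_eventually)
  show "((\<lambda>s. surplus p N U u t \<omega> + p * (s - t)) \<longlongrightarrow> surplus p N U u t \<omega>) (at_right t)"
    by (auto intro!: tendsto_eq_intros)
  show "\<forall>\<^sub>F s in at_right t. surplus p N U u t \<omega> + p * (s - t) = surplus p N U u s \<omega>"
    using paths(3)[OF assms]
  proof eventually_elim
    case (elim s)
    then show ?case using surplus_same_count[of t \<omega> s u] by simp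
  qed
qed

lemma borel_measurable_surplus:
  assumes "0 \<le> t" shows "surplus p N U u t \<in> borel_measurable M"
proof -
  have "(\<lambda>\<omega>. \<Sum>i<N t \<omega>. U i \<omega>) \<in> borel_measurable M"
  proof (rule measurable_compose_countable[where f="\<lambda>k \<omega>. \<Sum>i<k. U i \<omega>"])
    show "(\<lambda>\<omega>. \<Sum>i<k. U i \<omega>) \<in> borel_measurable M" for k
      by (intro borel_measurable_sum claims_measurable)
  qed (rule poisson_process_measurable[OF arrivals assms])
  then show ?thesis
    unfolding surplus_def[abs_def] by simp
qed

text \<open>Arrivals are counted by unit jumps, so just before the claim number \<open>n + 1\<close> exactly \<open>n\<close> claims
  have arrived; the open interval of such times contains a rational number.\<close>

lemma rational_time_between_claims:
  assumes \<omega>: "\<omega> \<in> space M" and "0 \<le> t" "Suc n \<le> N t \<omega>"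
  obtains q where "q \<in> \<rat>" "0 \<le> q" "q < t" "n \<le> N q \<omega>" "N q \<omega> < N t \<omega>"
proof -
  define \<tau> where "\<tau> = first_time (\<lambda>s. Suc n \<le> N s \<omega>)"
  have \<tau>_le: "\<tau> \<le> ereal s \<longleftrightarrow> Suc n \<le> N s \<omega>" if "0 \<le> s" for s
    unfolding \<tau>_def by (intro first_time_count_le_iff paths(2,3)[OF \<omega>] that)
  have "\<tau> \<le> ereal t" using \<tau>_le[OF assms(2)] assms(3) by simp
  moreover have "0 \<le> \<tau>" unfolding \<tau>_def by (rule first_time_nonneg)
  ultimately obtain r where r: "\<tau> = ereal r" "0 \<le> r" "r \<le> t"
    by (cases \<tau>) auto
  have reached: "Suc n \<le> N r \<omega>" using \<tau>_le[OF r(2)] r(1) by simp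
  then have "r \<noteq> 0" using paths(1)[OF \<omega>] by auto
  with r(2) have "0 < r" by simp
  then obtain b where b: "b < r" "\<And>s. b < s \<Longrightarrow> s < r \<Longrightarrow> N r \<omega> \<le> Suc (N s \<omega>)"
    using paths(4)[OF \<omega> \<open>0 < r\<close>] unfolding eventually_at_left_field by blast
  have "max 0 b < r" using b(1) \<open>0 < r\<close> by simp
  then obtain q where q: "q \<in> \<rat>" "max 0 b < q" "q < r" using Rats_dense_in_real by blast
  have "\<not> \<tau> \<le> ereal q" using q(3) r(1) by simp
  then have "N q \<omega> < Suc n" using \<tau>_le[of q] q(2) by simp
  then have "N q \<omega> < N t \<omega>" using assms(3) by simp
  moreover have "n \<le> N q \<omega>" using b(2)[of q] q reached by simp
  ultimately show ?thesis using that[of q] q r by simp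
qed

text \<open>At least \<open>n + 1\<close> claims have arrived by time \<open>s\<close> iff at some earlier rational time \<open>q\<close> at least
  \<open>n\<close> had arrived and the surplus afterwards fell below the premium line started at \<open>q\<close>. By
  induction on \<open>n\<close> the event is determined by the surplus process.\<close>

lemma count_observable:
  assumes space: "\<And>t. space (\<F> t) = space M"
    and adapted: "\<And>s t. 0 \<le> s \<Longrightarrow> s \<le> t \<Longrightarrow> surplus p N U u s \<in> borel_measurable (\<F> t)"
    and "0 \<le> s" "s \<le> t"
  shows "{\<omega> \<in> space M. n \<le> N s \<omega>} \<in> sets (\<F> t)"
  using \<open>0 \<le> s\<close> \<open>s \<le> t\<close>
proof (induction n arbitrary: s)
  case 0
  then show ?case
    using space[of t] sets.top[of "\<F> t"] by simp
next
  case (Suc n)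
  let ?Q = "{q\<in>\<rat>. 0 \<le> q \<and> q < s}"
  have "{\<omega> \<in> space M. Suc n \<le> N s \<omega>} = (\<Union>q\<in>?Q. {\<omega> \<in> space M. n \<le> N q \<omega>} \<inter>
      {\<omega> \<in> space M. surplus p N U u s \<omega> < surplus p N U u q \<omega> + p * (s - q)})"
    (is "?l = (\<Union>q\<in>?Q. ?r q)")
  proof (intro set_eqI iffI)
    fix \<omega> assume "\<omega> \<in> (\<Union>q\<in>?Q. ?r q)"
    then obtain q where q: "\<omega> \<in> space M" "0 \<le> q" "q < s" "n \<le> N q \<omega>"
      "surplus p N U u s \<omega> < surplus p N U u q \<omega> + p * (s - q)" by blast
    then have "N q \<omega> \<noteq> N s \<omega>"
      using surplus_same_count[of q \<omega> s] by auto
    then show "\<omega> \<in> ?l"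
      using q paths(2)[OF q(1), of q s] by simp
  next
    fix \<omega> assume "\<omega> \<in> ?l"
    then have \<omega>: "\<omega> \<in> space M" and n: "Suc n \<le> N s \<omega>" by simp_all
    then obtain q where "q \<in> \<rat>" "0 \<le> q" "q < s" "n \<le> N q \<omega>" "N q \<omega> < N s \<omega>"
      using rational_time_between_claims Suc.prems by metis
    then show "\<omega> \<in> (\<Union>q\<in>?Q. ?r q)"
      using \<omega> surplus_after_claim[OF \<omega>, of q s u] by (intro UN_I[of q]) simp_all
  qed
  also have "\<dots> \<in> sets (\<F> t)"
  proof (intro sets.countable_UN'' sets.Int)
    show "countable ?Q"
      by (rule countable_subset[OF _ countable_rat]) auto
    fix q assume "q \<in> ?Q"
    then have q: "0 \<le> q" "q < s" by auto
    show "{\<omega> \<in> space M. n \<le> N q \<omega>} \<in> sets (\<F> t)"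
      using Suc.IH[OF q(1)] Suc.prems q by simp
    have "surplus p N U u q \<in> borel_measurable (\<F> t)" "surplus p N U u s \<in> borel_measurable (\<F> t)"
      using adapted q Suc.prems by simp_all
    then have "{\<omega> \<in> space (\<F> t). surplus p N U u s \<omega> < surplus p N U u q \<omega> + p * (s - q)} \<in> sets (\<F> t)"
      by measurable
    then show "{\<omega> \<in> space M. surplus p N U u s \<omega> < surplus p N U u q \<omega> + p * (s - q)} \<in> sets (\<F> t)"
      by (simp add: space)
  qed
  finally show ?case .
qed

lemma count_adapted:
  assumes space: "\<And>t. space (\<F> t) = space M"
    and adapted: "\<And>s t. 0 \<le> s \<Longrightarrow> s \<le> t \<Longrightarrow> surplus p N U u s \<in> borel_measurable (\<F> t)"
    and "0 \<le> s" "s \<le> t"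
  shows "N s \<in> measurable (\<F> t) (count_space UNIV)"
proof -
  note obs = count_observable[OF assms]
  have "N s -` {n} \<inter> space (\<F> t) = {\<omega> \<in> space M. n \<le> N s \<omega>} - {\<omega> \<in> space M. Suc n \<le> N s \<omega>}" for n
    by (auto simp: space)
  then show ?thesis
    using obs by (simp add: measurable_count_space_eq2_countable)
qed

end

section \<open>Switching a dividend path to take-the-money-and-run\<close>

text \<open>Here \<open>u\<close> is the surplus at the switching time \<open>\<tau>\<close>. It can be negative on paths that are
  ruined by then; taking \<open>max 0 u\<close> keeps the path non-decreasing there as well.\<close>

definition switch_to_run :: "real \<Rightarrow> ereal \<Rightarrow> real \<Rightarrow> (real \<Rightarrow> real) \<Rightarrow> real \<Rightarrow> real" where
  "switch_to_run p \<tau> u l t = (if ereal t \<le> \<tau> then l t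
     else l (real_of_ereal \<tau>) + max 0 u + p * (t - real_of_ereal \<tau>))"

lemma switch_to_run_before: "ereal t \<le> \<tau> \<Longrightarrow> switch_to_run p \<tau> u l t = l t"
  by (simp add: switch_to_run_def)

lemma switch_to_run_after: "s < t \<Longrightarrow> switch_to_run p (ereal s) u l t = l s + max 0 u + p * (t - s)"
  by (simp add: switch_to_run_def)

lemma dividend_path_switch_to_run:
  assumes l: "dividend_path l" and "0 \<le> p" and "0 \<le> \<tau>"
  shows "dividend_path (switch_to_run p \<tau> u l)"
proof (cases \<tau>)
  case PInf
  then have "switch_to_run p \<tau> u l = l" by (simp add: switch_to_run_def fun_eq_iff)
  with l show ?thesis by simp
next
  case MInf
  with \<open>0 \<le> \<tau>\<close> show ?thesis by simp
next
  case (real s)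
  with \<open>0 \<le> \<tau>\<close> have s: "0 \<le> s" by simp
  let ?l = "switch_to_run p (ereal s) u l"
  have before: "?l t = l t" if "t \<le> s" for t
    using that by (simp add: switch_to_run_before)
  note after = switch_to_run_after[of s _ p u l]
  have "?l q \<le> ?l r" if "0 \<le> q" "q \<le> r" for q r
  proof -
    consider "r \<le> s" | "q \<le> s" "s < r" | "s < q" using \<open>q \<le> r\<close> by linarith
    then show ?thesis
    proof cases
      case 1
      then show ?thesis using that dividend_pathD(2)[OF l that] by (simp add: before)
    next
      case 2
      have "l q \<le> l s" using dividend_pathD(2)[OF l that(1) 2(1)] .
      moreover have "0 \<le> p * (r - s)" using 2 \<open>0 \<le> p\<close> by simp
      ultimately show ?thesis using 2 by (simp add: before after)
    next
      case 3
      then show ?thesis using that \<open>0 \<le> p\<close> by (simp add: after mult_left_mono)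
    qed
  qed
  moreover have "(?l \<longlongrightarrow> ?l t) (at_left t)" if "0 < t" for t
  proof (cases "t \<le> s")
    case True
    have "\<forall>\<^sub>F q in at_left t. l q = ?l q"
      using eventually_at_left_real[OF that] True by (auto elim!: eventually_mono simp: before)
    with dividend_pathD(4)[OF l that] show ?thesis
      using True by (auto simp: before intro: Lim_transform_eventually)
  next
    case False
    have "((\<lambda>q. l s + max 0 u + p * (q - s)) \<longlongrightarrow> l s + max 0 u + p * (t - s)) (at_left t)"
      by (intro tendsto_intros)
    moreover have "\<forall>\<^sub>F q in at_left t. l s + max 0 u + p * (q - s) = ?l q"
      using eventually_at_left_real[of s t] False by (auto elim!: eventually_mono simp: after)
    ultimately show ?thesis
      using False by (auto simp: after intro: Lim_transform_eventually)
  qed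
  moreover have "\<exists>c. (?l \<longlongrightarrow> c) (at_right t)" if "0 \<le> t" for t
  proof (cases "t < s")
    case True
    have "\<forall>\<^sub>F q in at_right t. l q = ?l q"
      using eventually_at_right_real[OF True] by (auto elim!: eventually_mono simp: before)
    with dividend_pathD(5)[OF l that] show ?thesis
      by (auto intro: Lim_transform_eventually)
  next
    case False
    have "((\<lambda>q. l s + max 0 u + p * (q - s)) \<longlongrightarrow> l s + max 0 u + p * (t - s)) (at_right t)"
      by (intro tendsto_intros)
    moreover have "\<forall>\<^sub>F q in at_right t. l s + max 0 u + p * (q - s) = ?l q"
      using eventually_at_right_less[of t] False by (auto elim!: eventually_mono simp: after)
    ultimately show ?thesis
      by (auto intro: Lim_transform_eventually)
  qed
  moreover have "?l 0 = 0"
    using dividend_pathD(1)[OF l] s by (simp add: before)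
  ultimately show ?thesis
    unfolding real dividend_path_def by (auto simp: mono_on_def continuous_within)
qed

section \<open>Claim times and transfers\<close>

context two_company_model
begin

interpretation one: claim_process M \<kappa>1 p1 N1 U1
  by unfold_locales (use arrivals claims_measurable claims_pos in auto)

interpretation two: claim_process M \<kappa>2 p2 N2 U2
  by unfold_locales (use arrivals claims_measurable claims_pos in auto)

lemma claim_time_le_iff:
  assumes "\<omega> \<in> space M" "0 \<le> t"
  shows "claim_time n \<omega> \<le> ereal t \<longleftrightarrow> n \<le> N1 t \<omega> + N2 t \<omega>"
  unfolding claim_time_def
proof (rule first_time_count_le_iff[OF _ _ assms(2)])
  show "N1 s \<omega> + N2 s \<omega> \<le> N1 t \<omega> + N2 t \<omega>" if "0 \<le> s" "s \<le> t" for s t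
    using one.paths(2)[OF assms(1) that] two.paths(2)[OF assms(1) that] by simp
  show "\<forall>\<^sub>F s in at_right t. N1 s \<omega> + N2 s \<omega> = N1 t \<omega> + N2 t \<omega>" if "0 \<le> t" for t
    using one.paths(3)[OF assms(1) that] two.paths(3)[OF assms(1) that] by eventually_elim simp
qed

lemma claim_time_nonneg: "0 \<le> claim_time n \<omega>"
  unfolding claim_time_def by (rule first_time_nonneg)

lemma claim_time_mono: "m \<le> n \<Longrightarrow> claim_time m \<omega> \<le> claim_time n \<omega>"
  unfolding claim_time_def by (intro first_time_greatest first_time_le) auto

lemma claim_time_unbounded:
  assumes "\<omega> \<in> space M" shows "\<exists>n. ereal r < claim_time n \<omega>"
proof -
  have "\<not> claim_time (Suc (N1 (max 0 r) \<omega> + N2 (max 0 r) \<omega>)) \<omega> \<le> ereal (max 0 r)"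
    using claim_time_le_iff[OF assms, of "max 0 r"] by simp
  then show ?thesis
    by (auto simp: not_le intro: le_less_trans[of "ereal r" "ereal (max 0 r)"])
qed

text \<open>Transfers move money between the companies, so they cancel in the total surplus. The ruin time
  therefore depends on the dividends and the uncontrolled surpluses only.\<close>

lemma controlled_total:
  "controlled_X x y L1 L2 t \<omega> + controlled_Y x y L1 L2 t \<omega> = X x t \<omega> - L1 t \<omega> + (Y y t \<omega> - L2 t \<omega>)"
  by (simp add: controlled_X_def controlled_Y_def)

text \<open>The transfers are settled claim by claim from the dividends paid so far, so dividends after time
  \<open>\<sigma>\<close> do not affect how the claims up to \<open>\<sigma>\<close> are settled.\<close>

lemma transfers_cong:
  assumes agree: "\<And>t. 0 \<le> t \<Longrightarrow> ereal t \<le> \<sigma> \<Longrightarrow> L1 t \<omega> = L1' t \<omega> \<and> L2 t \<omega> = L2' t \<omega>"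
    and "claim_time n \<omega> \<le> \<sigma>" "claim_time n \<omega> \<noteq> \<infinity>"
  shows "transfers x y L1 L2 \<omega> n = transfers x y L1' L2' \<omega> n"
  using assms(2,3)
proof (induction n)
  case (Suc n)
  define s where "s = real_of_ereal (claim_time (Suc n) \<omega>)"
  have s: "claim_time (Suc n) \<omega> = ereal s" "0 \<le> s"
    using Suc.prems claim_time_nonneg[of "Suc n" \<omega>] by (cases "claim_time (Suc n) \<omega>"; simp add: s_def)+
  have le: "claim_time n \<omega> \<le> ereal s"
    using claim_time_mono[of n "Suc n" \<omega>] s by simp
  have "transfers x y L1 L2 \<omega> n = transfers x y L1' L2' \<omega> n"
    using le Suc.prems s by (intro Suc.IH) auto
  moreover have "L1 s \<omega> = L1' s \<omega>" "L2 s \<omega> = L2' s \<omega>"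
    using agree[of s] s Suc.prems by simp_all
  ultimately show ?case
    by (simp add: s_def[symmetric] split_beta Let_def)
qed simp

lemma controlled_cong:
  assumes agree: "\<And>t. 0 \<le> t \<Longrightarrow> ereal t \<le> \<sigma> \<Longrightarrow> L1 t \<omega> = L1' t \<omega> \<and> L2 t \<omega> = L2' t \<omega>"
    and \<omega>: "\<omega> \<in> space M" and t: "0 \<le> t" "ereal t \<le> \<sigma>"
  shows "C21 x y L1 L2 t \<omega> = C21 x y L1' L2' t \<omega>" "C12 x y L1 L2 t \<omega> = C12 x y L1' L2' t \<omega>"
    "controlled_X x y L1 L2 t \<omega> = controlled_X x y L1' L2' t \<omega>"
    "controlled_Y x y L1 L2 t \<omega> = controlled_Y x y L1' L2' t \<omega>"
proof -
  have "claim_time (N1 t \<omega> + N2 t \<omega>) \<omega> \<le> ereal t"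
    using claim_time_le_iff[OF \<omega> t(1)] by simp
  then have "transfers x y L1 L2 \<omega> (N1 t \<omega> + N2 t \<omega>) = transfers x y L1' L2' \<omega> (N1 t \<omega> + N2 t \<omega>)"
    using t(2) by (intro transfers_cong[where \<sigma>=\<sigma>] agree) auto
  then show "C21 x y L1 L2 t \<omega> = C21 x y L1' L2' t \<omega>" "C12 x y L1 L2 t \<omega> = C12 x y L1' L2' t \<omega>"
    "controlled_X x y L1 L2 t \<omega> = controlled_X x y L1' L2' t \<omega>"
    "controlled_Y x y L1 L2 t \<omega> = controlled_Y x y L1' L2' t \<omega>"
    using agree[OF t] by (simp_all add: controlled_X_def controlled_Y_def C21_def C12_def)
qed

lemma transfers_between_claims:
  assumes "N1 s \<omega> + N2 s \<omega> = N1 t \<omega> + N2 t \<omega>"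
  shows "C21 x y L1 L2 s \<omega> = C21 x y L1 L2 t \<omega>" "C12 x y L1 L2 s \<omega> = C12 x y L1 L2 t \<omega>"
  using assms by (simp_all add: C21_def C12_def)

section \<open>Information generated by the surpluses\<close>

abbreviation info :: "real \<Rightarrow> real \<Rightarrow> real \<Rightarrow> 'w measure" where
  "info x y \<equiv> natural_filtration M (\<lambda>t \<omega>. (X x t \<omega>, Y y t \<omega>))"

lemma surplus_info:
  assumes "0 \<le> s" "s \<le> t"
  shows "X x s \<in> borel_measurable (info x y t)" "Y y s \<in> borel_measurable (info x y t)"
proof -
  have pair: "(\<lambda>\<omega>. (X x s \<omega>, Y y s \<omega>)) \<in> borel_measurable (info x y t)"
    using natural_filtration_adapted[OF assms, of "\<lambda>t \<omega>. (X x t \<omega>, Y y t \<omega>)"] .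
  have "fst \<in> borel_measurable (borel :: (real \<times> real) measure)"
      "snd \<in> borel_measurable (borel :: (real \<times> real) measure)"
    by (auto intro!: borel_measurable_continuous_onI continuous_intros)
  from measurable_compose[OF pair this(1)] measurable_compose[OF pair this(2)]
  show "X x s \<in> borel_measurable (info x y t)" "Y y s \<in> borel_measurable (info x y t)"
    by simp_all
qed

lemma counts_info:
  assumes "0 \<le> s" "s \<le> t"
  shows "(\<lambda>\<omega>. N1 s \<omega> + N2 s \<omega>) \<in> measurable (info x y t) (count_space UNIV)"
proof -
  have [measurable]: "N1 s \<in> measurable (info x y t) (count_space UNIV)"
      "N2 s \<in> measurable (info x y t) (count_space UNIV)"
    by (rule one.count_adapted[where u=x] two.count_adapted[where u=y]; simp add: surplus_info assms)+
  show ?thesis by measurable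
qed

lemma info_le:
  assumes "f \<in> measurable (info x y t) K" shows "f \<in> measurable M K"
  using _ assms
proof (rule measurable_natural_filtration_le)
  show "(\<lambda>\<omega>. (X x s \<omega>, Y y s \<omega>)) \<in> borel_measurable M" if "0 \<le> s" for s
    using one.borel_measurable_surplus[OF that] two.borel_measurable_surplus[OF that]
    by (simp add: borel_prod[symmetric])
qed

lemma min_claim_time_bounds:
  assumes "0 \<le> t"
  shows "ereal (real_of_ereal (min (claim_time n \<omega>) (ereal t))) = min (claim_time n \<omega>) (ereal t)"
    "0 \<le> real_of_ereal (min (claim_time n \<omega>) (ereal t))"
    "real_of_ereal (min (claim_time n \<omega>) (ereal t)) \<le> t"
  using claim_time_nonneg[of n \<omega>] assms
  by (cases "claim_time n \<omega>"; simp add: min_def)+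

text \<open>The claim time is a stopping time; capping it at \<open>t\<close> turns it into a real random variable that is
  known at time \<open>t\<close>.\<close>

lemma min_claim_time_info:
  assumes t: "0 \<le> t"
  shows "(\<lambda>\<omega>. real_of_ereal (min (claim_time n \<omega>) (ereal t))) \<in> borel_measurable (info x y t)"
    (is "?\<sigma> \<in> _")
proof (rule borel_measurable_iff_le[THEN iffD2, rule_format])
  fix a
  have iff: "?\<sigma> \<omega> \<le> a \<longleftrightarrow> claim_time n \<omega> \<le> ereal a \<or> t \<le> a" for \<omega>
    by (subst ereal_less_eq(3)[symmetric]) (simp add: min_claim_time_bounds[OF t] min_le_iff_disj)
  consider "t \<le> a" | "a < 0" | "0 \<le> a" "a < t" by linarith
  then show "{\<omega> \<in> space (info x y t). ?\<sigma> \<omega> \<le> a} \<in> sets (info x y t)"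
  proof cases
    case 1
    then have "{\<omega> \<in> space (info x y t). ?\<sigma> \<omega> \<le> a} = space (info x y t)" by (auto simp: iff)
    then show ?thesis by (metis sets.top)
  next
    case 2
    then have "{\<omega> \<in> space (info x y t). ?\<sigma> \<omega> \<le> a} = {}"
      using min_claim_time_bounds(2)[OF t, of n] by (auto simp: not_le intro: less_le_trans)
    then show ?thesis by (metis sets.empty_sets)
  next
    case 3
    then have "{\<omega> \<in> space (info x y t). ?\<sigma> \<omega> \<le> a} = {\<omega> \<in> space (info x y t). n \<le> N1 a \<omega> + N2 a \<omega>}"
      using claim_time_le_iff[OF _ 3(1)] by (auto simp: iff)
    also have "\<dots> \<in> sets (info x y t)"
      using counts_info[OF 3(1) less_imp_le[OF 3(2)], of x y] by measurable
    finally show ?thesis .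
  qed
qed

lemma info_mono:
  assumes "f \<in> measurable (info x y s) K" "s \<le> t"
  shows "f \<in> measurable (info x y t) K"
proof -
  have "measurable (info x y s) K \<subseteq> measurable (info x y t) K"
    using filtration.sets_F_mono[OF filtration_natural assms(2)] by (intro measurable_mono) auto
  with assms(1) show ?thesis by blast
qed

text \<open>Admissibility in terms of the controlled surpluses: before ruin neither of them is negative.\<close>

lemma strategies_iff:
  "(L1, L2) \<in> strategies x y \<longleftrightarrow> predictable (info x y) L1 \<and> predictable (info x y) L2 \<and>
     (\<forall>\<omega>\<in>space M. dividend_path (\<lambda>t. L1 t \<omega>) \<and> dividend_path (\<lambda>t. L2 t \<omega>) \<and>
        (\<forall>t\<ge>0. ereal t < ruin_time x y L1 L2 \<omega> \<longrightarrow>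
           0 \<le> controlled_X x y L1 L2 t \<omega> \<and> 0 \<le> controlled_Y x y L1 L2 t \<omega>) \<and>
        (\<forall>t. ruin_time x y L1 L2 \<omega> = ereal t \<longrightarrow>
           controlled_X x y L1 L2 t \<omega> + controlled_Y x y L1 L2 t \<omega> < 0))"
proof -
  have "L1 t \<omega> \<le> X x t \<omega> + C21 x y L1 L2 t \<omega> - C12 x y L1 L2 t \<omega> \<longleftrightarrow> 0 \<le> controlled_X x y L1 L2 t \<omega>"
    "L2 t \<omega> \<le> Y y t \<omega> + C12 x y L1 L2 t \<omega> - C21 x y L1 L2 t \<omega> \<longleftrightarrow> 0 \<le> controlled_Y x y L1 L2 t \<omega>"
    for t \<omega> by (auto simp: controlled_X_def controlled_Y_def)
  then show ?thesis
    by (auto simp: strategies_def dividend_process_iff)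
qed

lemma eval_at_claim_info:
  assumes adapted: "\<And>s. 0 \<le> s \<Longrightarrow> s \<le> t \<Longrightarrow> L s \<in> borel_measurable (info x y t)"
    and path: "\<And>\<omega>. \<omega> \<in> space M \<Longrightarrow> dividend_path (\<lambda>t. L t \<omega>)" and t: "0 \<le> t"
  shows "(\<lambda>\<omega>. L (real_of_ereal (min (claim_time n \<omega>) (ereal t))) \<omega>) \<in> borel_measurable (info x y t)"
proof (rule measurable_eval_left_continuous[where I="{..t}" and f=L
      and \<sigma>="\<lambda>\<omega>. real_of_ereal (min (claim_time n \<omega>) (ereal t))"])
  show "(\<lambda>\<omega>. real_of_ereal (min (claim_time n \<omega>) (ereal t))) \<in> borel_measurable (info x y t)"
    using t by (rule min_claim_time_info)
  show "((\<lambda>q. L q \<omega>) \<longlongrightarrow> L s \<omega>) (at_left s)" if "\<omega> \<in> space (info x y t)" "0 < s" for \<omega> s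
    using dividend_pathD(4)[OF path that(2)] that(1) by simp
qed (use adapted min_claim_time_bounds[OF t] in auto)

lemma eval_at_claim_info_right:
  fixes R :: "real \<Rightarrow> 'w \<Rightarrow> real"
  assumes adapted: "\<And>s. 0 \<le> s \<Longrightarrow> s \<le> t \<Longrightarrow> R s \<in> borel_measurable (info x y t)"
    and right: "\<And>\<omega> s. \<omega> \<in> space M \<Longrightarrow> 0 \<le> s \<Longrightarrow> ((\<lambda>q. R q \<omega>) \<longlongrightarrow> R s \<omega>) (at_right s)"
    and t: "0 \<le> t"
  shows "(\<lambda>\<omega>. R (real_of_ereal (min (claim_time n \<omega>) (ereal t))) \<omega>) \<in> borel_measurable (info x y t)"
proof (rule measurable_eval_right_continuous[where u=t and f=R
      and \<sigma>="\<lambda>\<omega>. real_of_ereal (min (claim_time n \<omega>) (ereal t))"])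
  show "(\<lambda>\<omega>. real_of_ereal (min (claim_time n \<omega>) (ereal t))) \<in> borel_measurable (info x y t)"
    using t by (rule min_claim_time_info)
qed (use adapted right min_claim_time_bounds[OF t] in auto)

lemma claim_before_info:
  assumes t: "0 \<le> t"
  shows "{\<omega> \<in> space (info x y t). claim_time n \<omega> \<le> ereal t} \<in> sets (info x y t)"
    and "{\<omega> \<in> space (info x y t). claim_time n \<omega> < ereal t} \<in> sets (info x y t)"
proof -
  have "{\<omega> \<in> space (info x y t). claim_time n \<omega> \<le> ereal t} = {\<omega> \<in> space (info x y t). n \<le> N1 t \<omega> + N2 t \<omega>}"
    using claim_time_le_iff[OF _ t] by auto
  also have "\<dots> \<in> sets (info x y t)"
    using counts_info[OF t order_refl, of x y] by measurable
  finally show "{\<omega> \<in> space (info x y t). claim_time n \<omega> \<le> ereal t} \<in> sets (info x y t)" .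
  have "claim_time n \<omega> < ereal t \<longleftrightarrow> real_of_ereal (min (claim_time n \<omega>) (ereal t)) < t" for \<omega>
    by (subst less_ereal.simps(1)[symmetric]) (simp add: min_claim_time_bounds[OF t] min_less_iff_disj)
  then have "{\<omega> \<in> space (info x y t). claim_time n \<omega> < ereal t}
      = {\<omega> \<in> space (info x y t). real_of_ereal (min (claim_time n \<omega>) (ereal t)) < t}" by simp
  also have "\<dots> \<in> sets (info x y t)"
    using min_claim_time_info[OF t, of n x y] by measurable
  finally show "{\<omega> \<in> space (info x y t). claim_time n \<omega> < ereal t} \<in> sets (info x y t)" .
qed

text \<open>The recursion for the transfers can be carried out with the information at time \<open>t\<close> if every claim
  time is capped at \<open>t\<close>; where the \<open>n\<close>-th claim has arrived by \<open>t\<close>, the caps have no effect.\<close>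

lemma settled_transfers_info:
  assumes adapted: "\<And>s. 0 \<le> s \<Longrightarrow> s \<le> t \<Longrightarrow> L1 s \<in> borel_measurable (info x y t)"
      "\<And>s. 0 \<le> s \<Longrightarrow> s \<le> t \<Longrightarrow> L2 s \<in> borel_measurable (info x y t)"
    and path: "\<And>\<omega>. \<omega> \<in> space M \<Longrightarrow> dividend_path (\<lambda>t. L1 t \<omega>)"
      "\<And>\<omega>. \<omega> \<in> space M \<Longrightarrow> dividend_path (\<lambda>t. L2 t \<omega>)"
    and t: "0 \<le> t"
  shows "(\<lambda>\<omega>. if claim_time n \<omega> \<le> ereal t then fst (transfers x y L1 L2 \<omega> n) else 0) \<in> borel_measurable (info x y t) \<and>
    (\<lambda>\<omega>. if claim_time n \<omega> \<le> ereal t then snd (transfers x y L1 L2 \<omega> n) else 0) \<in> borel_measurable (info x y t)"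
proof (induction n)
  case 0
  show ?case
    by (simp only: transfers.simps fst_conv snd_conv if_cancel borel_measurable_const simp_thms)
next
  case (Suc n)
  define c21 where "c21 = (\<lambda>\<omega>. if claim_time n \<omega> \<le> ereal t then fst (transfers x y L1 L2 \<omega> n) else 0)"
  define c12 where "c12 = (\<lambda>\<omega>. if claim_time n \<omega> \<le> ereal t then snd (transfers x y L1 L2 \<omega> n) else 0)"
  let ?\<sigma> = "\<lambda>\<omega>. real_of_ereal (min (claim_time (Suc n) \<omega>) (ereal t))"
  define A where "A = {\<omega> \<in> space (info x y t). claim_time (Suc n) \<omega> \<le> ereal t}"
  define x' where "x' = (\<lambda>\<omega>. X x (?\<sigma> \<omega>) \<omega> - L1 (?\<sigma> \<omega>) \<omega> + c21 \<omega> - c12 \<omega>)"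
  define y' where "y' = (\<lambda>\<omega>. Y y (?\<sigma> \<omega>) \<omega> - L2 (?\<sigma> \<omega>) \<omega> + c12 \<omega> - c21 \<omega>)"
  have c[measurable]: "c21 \<in> borel_measurable (info x y t)" "c12 \<in> borel_measurable (info x y t)"
    using Suc.IH by (simp_all add: c21_def c12_def)
  have [measurable]: "A \<in> sets (info x y t)"
    unfolding A_def by (rule claim_before_info(1)[OF t])
  have X: "(\<lambda>\<omega>. X x (?\<sigma> \<omega>) \<omega>) \<in> borel_measurable (info x y t)"
    "(\<lambda>\<omega>. Y y (?\<sigma> \<omega>) \<omega>) \<in> borel_measurable (info x y t)"
    by (rule eval_at_claim_info_right; simp add: surplus_info one.surplus_right_continuous two.surplus_right_continuous t)+
  have L: "(\<lambda>\<omega>. L1 (?\<sigma> \<omega>) \<omega>) \<in> borel_measurable (info x y t)"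
    "(\<lambda>\<omega>. L2 (?\<sigma> \<omega>) \<omega>) \<in> borel_measurable (info x y t)"
    by (rule eval_at_claim_info; simp add: adapted path t)+
  have [measurable]: "x' \<in> borel_measurable (info x y t)" "y' \<in> borel_measurable (info x y t)"
    unfolding x'_def y'_def using X L c by simp_all
  have step: "transfers x y L1 L2 \<omega> (Suc n)
      = (if 0 \<le> x' \<omega> + y' \<omega> then (c21 \<omega> + max 0 (- x' \<omega>), c12 \<omega> + max 0 (- y' \<omega>)) else (c21 \<omega>, c12 \<omega>))"
    if "claim_time (Suc n) \<omega> \<le> ereal t" for \<omega>
  proof -
    have "claim_time n \<omega> \<le> ereal t"
      using claim_time_mono[of n "Suc n" \<omega>] that by simp
    then show ?thesis
      using that by (simp add: x'_def y'_def c21_def c12_def min_absorb1 split_beta Let_def)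
  qed
  have m: "(\<lambda>\<omega>. if \<omega> \<in> A then (if 0 \<le> x' \<omega> + y' \<omega> then c21 \<omega> + max 0 (- x' \<omega>) else c21 \<omega>) else 0)
      \<in> borel_measurable (info x y t)"
    "(\<lambda>\<omega>. if \<omega> \<in> A then (if 0 \<le> x' \<omega> + y' \<omega> then c12 \<omega> + max 0 (- y' \<omega>) else c12 \<omega>) else 0)
      \<in> borel_measurable (info x y t)"
    by measurable
  have eq: "(if claim_time (Suc n) \<omega> \<le> ereal t then fst (transfers x y L1 L2 \<omega> (Suc n)) else 0)
      = (if \<omega> \<in> A then (if 0 \<le> x' \<omega> + y' \<omega> then c21 \<omega> + max 0 (- x' \<omega>) else c21 \<omega>) else 0)"
    "(if claim_time (Suc n) \<omega> \<le> ereal t then snd (transfers x y L1 L2 \<omega> (Suc n)) else 0)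
      = (if \<omega> \<in> A then (if 0 \<le> x' \<omega> + y' \<omega> then c12 \<omega> + max 0 (- y' \<omega>) else c12 \<omega>) else 0)"
    if "\<omega> \<in> space (info x y t)" for \<omega>
    using that step[of \<omega>]
    by (cases "claim_time (Suc n) \<omega> \<le> ereal t"; cases "0 \<le> x' \<omega> + y' \<omega>"; simp add: A_def del: transfers.simps)+
  show ?case
    using measurable_cong[THEN iffD2, OF eq(1) m(1)] measurable_cong[THEN iffD2, OF eq(2) m(2)] by (rule conjI)
qed

lemma transfers_adapted:
  assumes adapted: "\<And>s. 0 \<le> s \<Longrightarrow> s \<le> t \<Longrightarrow> L1 s \<in> borel_measurable (info x y t)"
      "\<And>s. 0 \<le> s \<Longrightarrow> s \<le> t \<Longrightarrow> L2 s \<in> borel_measurable (info x y t)"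
    and path: "\<And>\<omega>. \<omega> \<in> space M \<Longrightarrow> dividend_path (\<lambda>t. L1 t \<omega>)"
      "\<And>\<omega>. \<omega> \<in> space M \<Longrightarrow> dividend_path (\<lambda>t. L2 t \<omega>)"
    and t: "0 \<le> t"
  shows "C21 x y L1 L2 t \<in> borel_measurable (info x y t)" "C12 x y L1 L2 t \<in> borel_measurable (info x y t)"
proof -
  note tr = settled_transfers_info[of t L1 x y L2, OF adapted path t]
  have le: "claim_time (N1 t \<omega> + N2 t \<omega>) \<omega> \<le> ereal t" if "\<omega> \<in> space M" for \<omega>
    using claim_time_le_iff[OF that t] by simp
  have "(\<lambda>\<omega>. if claim_time (N1 t \<omega> + N2 t \<omega>) \<omega> \<le> ereal t
      then fst (transfers x y L1 L2 \<omega> (N1 t \<omega> + N2 t \<omega>)) else 0) \<in> borel_measurable (info x y t)"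
    by (rule measurable_compose_countable[OF tr[THEN conjunct1] counts_info[OF t order_refl]])
  then show "C21 x y L1 L2 t \<in> borel_measurable (info x y t)"
    by (rule measurable_cong[THEN iffD1, rotated]) (simp add: C21_def le)
  have "(\<lambda>\<omega>. if claim_time (N1 t \<omega> + N2 t \<omega>) \<omega> \<le> ereal t
      then snd (transfers x y L1 L2 \<omega> (N1 t \<omega> + N2 t \<omega>)) else 0) \<in> borel_measurable (info x y t)"
    by (rule measurable_compose_countable[OF tr[THEN conjunct2] counts_info[OF t order_refl]])
  then show "C12 x y L1 L2 t \<in> borel_measurable (info x y t)"
    by (rule measurable_cong[THEN iffD1, rotated]) (simp add: C12_def le)
qed

lemma transfers_right_continuous:
  assumes "\<omega> \<in> space M" "0 \<le> t"
  shows "((\<lambda>s. C21 x y L1 L2 s \<omega>) \<longlongrightarrow> C21 x y L1 L2 t \<omega>) (at_right t)"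
    "((\<lambda>s. C12 x y L1 L2 s \<omega>) \<longlongrightarrow> C12 x y L1 L2 t \<omega>) (at_right t)"
proof -
  have "\<forall>\<^sub>F s in at_right t. N1 s \<omega> + N2 s \<omega> = N1 t \<omega> + N2 t \<omega>"
    using one.paths(3)[OF assms] two.paths(3)[OF assms] by eventually_elim simp
  then have "\<forall>\<^sub>F s in at_right t. C21 x y L1 L2 s \<omega> = C21 x y L1 L2 t \<omega>"
    "\<forall>\<^sub>F s in at_right t. C12 x y L1 L2 s \<omega> = C12 x y L1 L2 t \<omega>"
    by (eventually_elim, simp add: C21_def C12_def)+
  then show "((\<lambda>s. C21 x y L1 L2 s \<omega>) \<longlongrightarrow> C21 x y L1 L2 t \<omega>) (at_right t)"
    "((\<lambda>s. C12 x y L1 L2 s \<omega>) \<longlongrightarrow> C12 x y L1 L2 t \<omega>) (at_right t)"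
    by (simp_all add: tendsto_eventually)
qed

section \<open>The switched strategy\<close>

text \<open>\<open>D\<close> is the controlled surplus of the company that pays \<open>L\<close>.\<close>

definition switch_at_claim ::
  "nat \<Rightarrow> real \<Rightarrow> (real \<Rightarrow> 'w \<Rightarrow> real) \<Rightarrow> (real \<Rightarrow> 'w \<Rightarrow> real) \<Rightarrow> real \<Rightarrow> 'w \<Rightarrow> real" where
  "switch_at_claim n p D L t \<omega> =
     switch_to_run p (claim_time n \<omega>) (D (real_of_ereal (claim_time n \<omega>)) \<omega>) (\<lambda>t. L t \<omega>) t"

lemma switch_at_claim_path:
  "dividend_path (\<lambda>t. L t \<omega>) \<Longrightarrow> 0 \<le> p \<Longrightarrow> dividend_path (\<lambda>t. switch_at_claim n p D L t \<omega>)"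
  unfolding switch_at_claim_def using claim_time_nonneg by (intro dividend_path_switch_to_run)

text \<open>The controlled surplus \<open>D\<close> has no one-sided continuity: \<open>L\<close> is continuous from the left and the
  claims and transfers from the right. It is therefore split as \<open>D = R - L\<close>, and the two parts are
  sampled from their own sides.\<close>

lemma switch_at_claim_predictable:
  fixes R :: "real \<Rightarrow> 'w \<Rightarrow> real"
  assumes L: "\<And>s t. 0 \<le> s \<Longrightarrow> s \<le> t \<Longrightarrow> L s \<in> borel_measurable (info x y t)"
    and path: "\<And>\<omega>. \<omega> \<in> space M \<Longrightarrow> dividend_path (\<lambda>t. L t \<omega>)" and "0 \<le> p"
    and R: "\<And>s t. 0 \<le> s \<Longrightarrow> s \<le> t \<Longrightarrow> R s \<in> borel_measurable (info x y t)"
    and right: "\<And>\<omega> s. \<omega> \<in> space M \<Longrightarrow> 0 \<le> s \<Longrightarrow> ((\<lambda>q. R q \<omega>) \<longlongrightarrow> R s \<omega>) (at_right s)"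
    and D: "\<And>s \<omega>. D s \<omega> = R s \<omega> - L s \<omega>"
  shows "predictable (info x y) (switch_at_claim n p D L)"
proof (rule left_continuous_adapted_predictable[OF filtration_natural])
  show "((\<lambda>s. switch_at_claim n p D L s \<omega>) \<longlongrightarrow> switch_at_claim n p D L t \<omega>) (at_left t)"
    if "\<omega> \<in> space M" "0 < t" for \<omega> t
    by (intro dividend_pathD(4)[of "\<lambda>t. switch_at_claim n p D L t \<omega>"] switch_at_claim_path path that \<open>0 \<le> p\<close>)
  fix t :: real assume t: "0 \<le> t"
  let ?\<sigma> = "\<lambda>\<omega>. real_of_ereal (min (claim_time n \<omega>) (ereal t))"
  define A where "A = {\<omega> \<in> space (info x y t). claim_time n \<omega> < ereal t}"
  define \<sigma> where "\<sigma> = ?\<sigma>"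
  have [measurable]: "A \<in> sets (info x y t)"
    unfolding A_def by (rule claim_before_info(2)[OF t])
  have [measurable]: "\<sigma> \<in> borel_measurable (info x y t)"
    unfolding \<sigma>_def by (rule min_claim_time_info[OF t])
  have [measurable]: "(\<lambda>\<omega>. L (\<sigma> \<omega>) \<omega>) \<in> borel_measurable (info x y t)"
    unfolding \<sigma>_def by (rule eval_at_claim_info[OF L path t])
  have [measurable]: "(\<lambda>\<omega>. R (\<sigma> \<omega>) \<omega>) \<in> borel_measurable (info x y t)"
    unfolding \<sigma>_def by (rule eval_at_claim_info_right[OF R right t])
  have [measurable]: "L t \<in> borel_measurable (info x y t)"
    using L t by simp
  have m: "(\<lambda>\<omega>. if \<omega> \<in> A then L (\<sigma> \<omega>) \<omega> + max 0 (R (\<sigma> \<omega>) \<omega> - L (\<sigma> \<omega>) \<omega>) + p * (t - \<sigma> \<omega>) else L t \<omega>)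
      \<in> borel_measurable (info x y t)"
    by measurable
  have eq: "switch_at_claim n p D L t \<omega>
      = (if \<omega> \<in> A then L (\<sigma> \<omega>) \<omega> + max 0 (R (\<sigma> \<omega>) \<omega> - L (\<sigma> \<omega>) \<omega>) + p * (t - \<sigma> \<omega>) else L t \<omega>)"
    if "\<omega> \<in> space (info x y t)" for \<omega>
    using that by (auto simp: switch_at_claim_def switch_to_run_def A_def \<sigma>_def D min_absorb1 not_le)
  show "switch_at_claim n p D L t \<in> borel_measurable (info x y t)"
    by (rule measurable_cong[THEN iffD2, OF eq m])
qed

lemma counts_mono:
  assumes "\<omega> \<in> space M" "0 \<le> s" "s \<le> t"
  shows "N1 s \<omega> \<le> N1 t \<omega>" "N2 s \<omega> \<le> N2 t \<omega>"
  using one.paths(2)[OF assms] two.paths(2)[OF assms] by simp_all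

lemma total_surplus_after_claim:
  assumes "\<omega> \<in> space M" "0 \<le> s" "s \<le> t" "N1 s \<omega> + N2 s \<omega> < N1 t \<omega> + N2 t \<omega>"
  shows "X x t \<omega> + Y y t \<omega> < X x s \<omega> + Y y s \<omega> + p1 * (t - s) + p2 * (t - s)"
proof -
  have "N1 s \<omega> < N1 t \<omega> \<or> N2 s \<omega> < N2 t \<omega>"
    using assms(4) by linarith
  then show ?thesis
    using one.surplus_after_claim[OF assms(1), of s t x] two.surplus_after_claim[OF assms(1), of s t y]
      one.surplus_increment_le[OF assms(1-3), of x] two.surplus_increment_le[OF assms(1-3), of y]
    by linarith
qed

lemma strategiesD:
  assumes "(L1, L2) \<in> strategies x y"
  shows "predictable (info x y) L1" "predictable (info x y) L2"
    and "\<omega> \<in> space M \<Longrightarrow> dividend_path (\<lambda>t. L1 t \<omega>)" "\<omega> \<in> space M \<Longrightarrow> dividend_path (\<lambda>t. L2 t \<omega>)"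
    and "\<omega> \<in> space M \<Longrightarrow> 0 \<le> t \<Longrightarrow> ereal t < ruin_time x y L1 L2 \<omega> \<Longrightarrow> 0 \<le> controlled_X x y L1 L2 t \<omega>"
    and "\<omega> \<in> space M \<Longrightarrow> 0 \<le> t \<Longrightarrow> ereal t < ruin_time x y L1 L2 \<omega> \<Longrightarrow> 0 \<le> controlled_Y x y L1 L2 t \<omega>"
    and "\<omega> \<in> space M \<Longrightarrow> ruin_time x y L1 L2 \<omega> = ereal t \<Longrightarrow>
      controlled_X x y L1 L2 t \<omega> + controlled_Y x y L1 L2 t \<omega> < 0"
  using assms unfolding strategies_iff by blast+

lemma strategies_adapted:
  assumes "(L1, L2) \<in> strategies x y" "0 \<le> s" "s \<le> t"
  shows "L1 s \<in> borel_measurable (info x y t)" "L2 s \<in> borel_measurable (info x y t)"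
  using strategiesD(1,2)[OF assms(1)] assms(2,3)
  by (blast intro: info_mono predictable_adapted[OF filtration_natural])+

lemma ruin_time_nonneg: "0 \<le> ruin_time x y L1 L2 \<omega>"
  unfolding ruin_time_def by (rule first_time_nonneg)

abbreviation run1 where
  "run1 n x y L1 L2 \<equiv> switch_at_claim n p1 (controlled_X x y L1 L2) L1"

abbreviation run2 where
  "run2 n x y L1 L2 \<equiv> switch_at_claim n p2 (controlled_Y x y L1 L2) L2"

lemma switch_at_claim_before: "ereal t \<le> claim_time n \<omega> \<Longrightarrow> switch_at_claim n p D L t \<omega> = L t \<omega>"
  by (simp add: switch_at_claim_def switch_to_run_before)

lemma switch_at_claim_after:
  "claim_time n \<omega> = ereal s \<Longrightarrow> s < t \<Longrightarrow>
    switch_at_claim n p D L t \<omega> = L s \<omega> + max 0 (D s \<omega>) + p * (t - s)"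
  by (simp add: switch_at_claim_def switch_to_run_after)

lemma controlled_switch_before:
  assumes "\<omega> \<in> space M" "0 \<le> t" "ereal t \<le> claim_time n \<omega>"
  shows "C21 x y (run1 n x y L1 L2) (run2 n x y L1 L2) t \<omega> = C21 x y L1 L2 t \<omega>"
    "C12 x y (run1 n x y L1 L2) (run2 n x y L1 L2) t \<omega> = C12 x y L1 L2 t \<omega>"
    "controlled_X x y (run1 n x y L1 L2) (run2 n x y L1 L2) t \<omega> = controlled_X x y L1 L2 t \<omega>"
    "controlled_Y x y (run1 n x y L1 L2) (run2 n x y L1 L2) t \<omega> = controlled_Y x y L1 L2 t \<omega>"
  by (rule controlled_cong[where \<sigma>="claim_time n \<omega>"]; simp add: assms switch_at_claim_before)+

text \<open>Up to the switch both strategies agree, and ruin, if it occurs at all, occurs by then.\<close>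

lemma ruin_time_switch_of_ruined:
  assumes strat: "(L1, L2) \<in> strategies x y" and \<omega>: "\<omega> \<in> space M"
    and le: "ruin_time x y L1 L2 \<omega> \<le> claim_time n \<omega>"
  shows "ruin_time x y (run1 n x y L1 L2) (run2 n x y L1 L2) \<omega> = ruin_time x y L1 L2 \<omega>" (is "?T' = ?T")
proof (rule antisym)
  show "?T \<le> ?T'"
    unfolding ruin_time_def[of _ _ "run1 n x y L1 L2"]
  proof (rule first_time_greatest)
    fix t :: real
    assume t: "0 \<le> t"
      and neg: "controlled_X x y (run1 n x y L1 L2) (run2 n x y L1 L2) t \<omega>
        + controlled_Y x y (run1 n x y L1 L2) (run2 n x y L1 L2) t \<omega> < 0"
    show "?T \<le> ereal t"
    proof (rule ccontr)
      assume "\<not> ?T \<le> ereal t"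
      then have "ereal t < ?T" by simp
      then have "0 \<le> controlled_X x y L1 L2 t \<omega> + controlled_Y x y L1 L2 t \<omega>"
        using strategiesD(5,6)[OF strat \<omega> t] by simp
      moreover have "ereal t \<le> claim_time n \<omega>"
        using \<open>ereal t < ?T\<close> le by simp
      ultimately show False
        using neg by (simp add: controlled_switch_before[OF \<omega> t])
    qed
  qed
  show "?T' \<le> ?T"
  proof (cases ?T)
    case (real t)
    then have "0 \<le> t" using ruin_time_nonneg[of x y L1 L2 \<omega>] by simp
    moreover have "ereal t \<le> claim_time n \<omega>" using real le by simp
    ultimately have "?T' \<le> ereal t"
      using strategiesD(7)[OF strat \<omega> real] unfolding ruin_time_def[of _ _ "run1 n x y L1 L2"]
      by (intro first_time_le) (simp_all add: controlled_switch_before[OF \<omega>])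
    then show ?thesis using real by simp
  qed (use ruin_time_nonneg[of x y L1 L2 \<omega>] in simp_all)
qed

text \<open>Right after the switch both surpluses are paid out and the premiums are passed on, so the surpluses
  stay at \<open>0\<close> until the next claim. That claim makes their sum negative, and since all premiums
  are paid out, the sum never recovers.\<close>

lemma controlled_after_switch:
  assumes strat: "(L1, L2) \<in> strategies x y" and \<omega>: "\<omega> \<in> space M"
    and \<tau>: "claim_time n \<omega> = ereal s" "ereal s < ruin_time x y L1 L2 \<omega>" and t: "s < t"
  shows "N1 t \<omega> + N2 t \<omega> = N1 s \<omega> + N2 s \<omega> \<Longrightarrow>
      controlled_X x y (run1 n x y L1 L2) (run2 n x y L1 L2) t \<omega> = 0 \<and>
      controlled_Y x y (run1 n x y L1 L2) (run2 n x y L1 L2) t \<omega> = 0"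
    and "N1 s \<omega> + N2 s \<omega> < N1 t \<omega> + N2 t \<omega> \<Longrightarrow>
      controlled_X x y (run1 n x y L1 L2) (run2 n x y L1 L2) t \<omega> +
      controlled_Y x y (run1 n x y L1 L2) (run2 n x y L1 L2) t \<omega> < 0"
proof -
  have s: "0 \<le> s" using claim_time_nonneg[of n \<omega>] \<tau>(1) by simp
  have pos: "0 \<le> controlled_X x y L1 L2 s \<omega>" "0 \<le> controlled_Y x y L1 L2 s \<omega>"
    using strategiesD(5,6)[OF strat \<omega> s \<tau>(2)] .
  have L: "run1 n x y L1 L2 t \<omega> = L1 s \<omega> + controlled_X x y L1 L2 s \<omega> + p1 * (t - s)"
    "run2 n x y L1 L2 t \<omega> = L2 s \<omega> + controlled_Y x y L1 L2 s \<omega> + p2 * (t - s)"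
    using pos by (simp_all add: switch_at_claim_after[OF \<tau>(1) t])
  {
    assume eq: "N1 t \<omega> + N2 t \<omega> = N1 s \<omega> + N2 s \<omega>"
    have eq1: "N1 s \<omega> = N1 t \<omega>" "N2 s \<omega> = N2 t \<omega>"
      using eq counts_mono[OF \<omega> s less_imp_le[OF t]] by linarith+
    have C: "C21 x y (run1 n x y L1 L2) (run2 n x y L1 L2) t \<omega> = C21 x y L1 L2 s \<omega>"
      "C12 x y (run1 n x y L1 L2) (run2 n x y L1 L2) t \<omega> = C12 x y L1 L2 s \<omega>"
      using controlled_switch_before(1,2)[OF \<omega> s, of n x y L1 L2] \<tau>(1)
        transfers_between_claims[of t \<omega> s x y "run1 n x y L1 L2" "run2 n x y L1 L2"] eq by simp_all
    have XY: "X x t \<omega> = X x s \<omega> + p1 * (t - s)" "Y y t \<omega> = Y y s \<omega> + p2 * (t - s)"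
      using one.surplus_same_count[OF eq1(1)] two.surplus_same_count[OF eq1(2)] by simp_all
    show "controlled_X x y (run1 n x y L1 L2) (run2 n x y L1 L2) t \<omega> = 0 \<and>
      controlled_Y x y (run1 n x y L1 L2) (run2 n x y L1 L2) t \<omega> = 0"
      unfolding controlled_X_def[of x y "run1 n x y L1 L2"] controlled_Y_def[of x y "run1 n x y L1 L2"] C L XY
      by (simp add: controlled_X_def controlled_Y_def)
  next
    assume "N1 s \<omega> + N2 s \<omega> < N1 t \<omega> + N2 t \<omega>"
    from total_surplus_after_claim[OF \<omega> s less_imp_le[OF t] this, of x y]
    show "controlled_X x y (run1 n x y L1 L2) (run2 n x y L1 L2) t \<omega> +
      controlled_Y x y (run1 n x y L1 L2) (run2 n x y L1 L2) t \<omega> < 0"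
      using controlled_total[of x y L1 L2 s \<omega>] unfolding controlled_total[of x y "run1 n x y L1 L2"] L
      by linarith
  }
qed

text \<open>The index is not \<open>n + 1\<close>: if both companies face a claim at the switching time \<open>s\<close>, then more than
  \<open>n\<close> claims have arrived by \<open>s\<close>.\<close>

lemma ruin_time_switch:
  assumes strat: "(L1, L2) \<in> strategies x y" and \<omega>: "\<omega> \<in> space M"
    and \<tau>: "claim_time n \<omega> = ereal s" "ereal s < ruin_time x y L1 L2 \<omega>"
  shows "ruin_time x y (run1 n x y L1 L2) (run2 n x y L1 L2) \<omega> = claim_time (Suc (N1 s \<omega> + N2 s \<omega>)) \<omega>"
  unfolding ruin_time_def claim_time_def[of "Suc _"]
proof (rule first_time_cong)
  fix t :: real assume t: "0 \<le> t"
  have s: "0 \<le> s" using claim_time_nonneg[of n \<omega>] \<tau>(1) by simp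
  show "controlled_X x y (run1 n x y L1 L2) (run2 n x y L1 L2) t \<omega> +
      controlled_Y x y (run1 n x y L1 L2) (run2 n x y L1 L2) t \<omega> < 0 \<longleftrightarrow>
      Suc (N1 s \<omega> + N2 s \<omega>) \<le> N1 t \<omega> + N2 t \<omega>"
  proof (cases "t \<le> s")
    case True
    then have "ereal t < ruin_time x y L1 L2 \<omega>"
      using le_less_trans[OF _ \<tau>(2), of "ereal t"] by simp
    then have "0 \<le> controlled_X x y (run1 n x y L1 L2) (run2 n x y L1 L2) t \<omega>"
      "0 \<le> controlled_Y x y (run1 n x y L1 L2) (run2 n x y L1 L2) t \<omega>"
      using strategiesD(5,6)[OF strat \<omega> t] True \<tau>(1) by (simp_all add: controlled_switch_before[OF \<omega> t])
    moreover have "N1 t \<omega> + N2 t \<omega> \<le> N1 s \<omega> + N2 s \<omega>"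
      using counts_mono[OF \<omega> t True] by linarith
    ultimately show ?thesis by simp
  next
    case False
    then have "s < t" by simp
    moreover have "N1 s \<omega> + N2 s \<omega> \<le> N1 t \<omega> + N2 t \<omega>"
      using counts_mono[OF \<omega> s, of t] \<open>s < t\<close> by linarith
    ultimately show ?thesis
      using controlled_after_switch[OF strat \<omega> \<tau> \<open>s < t\<close>] by (auto simp: le_less)
  qed
qed

lemma switch_in_strategies:
  assumes strat: "(L1, L2) \<in> strategies x y"
  shows "(run1 n x y L1 L2, run2 n x y L1 L2) \<in> strategies x y"
  unfolding strategies_iff
proof (intro conjI ballI allI impI)
  note adapted = strategies_adapted[OF strat] and path = strategiesD(3,4)[OF strat]
  have C_info: "C21 x y L1 L2 s \<in> borel_measurable (info x y t)" "C12 x y L1 L2 s \<in> borel_measurable (info x y t)"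
    if "0 \<le> s" "s \<le> t" for s t
    using transfers_adapted[of s L1 x y L2, OF adapted path that(1)] info_mono[OF _ that(2)] by simp_all
  show "predictable (info x y) (run1 n x y L1 L2)"
  proof (rule switch_at_claim_predictable[OF adapted(1) path(1)])
    show "(\<lambda>\<omega>. X x s \<omega> + C21 x y L1 L2 s \<omega> - C12 x y L1 L2 s \<omega>) \<in> borel_measurable (info x y t)"
      if "0 \<le> s" "s \<le> t" for s t
      using surplus_info(1)[OF that] C_info[OF that] by simp
    show "((\<lambda>q. X x q \<omega> + C21 x y L1 L2 q \<omega> - C12 x y L1 L2 q \<omega>)
        \<longlongrightarrow> X x s \<omega> + C21 x y L1 L2 s \<omega> - C12 x y L1 L2 s \<omega>) (at_right s)"
      if "\<omega> \<in> space M" "0 \<le> s" for \<omega> s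
      by (intro tendsto_intros one.surplus_right_continuous transfers_right_continuous that)
  qed (use premium_pos in \<open>simp_all add: controlled_X_def\<close>)
  show "predictable (info x y) (run2 n x y L1 L2)"
  proof (rule switch_at_claim_predictable[OF adapted(2) path(2)])
    show "(\<lambda>\<omega>. Y y s \<omega> + C12 x y L1 L2 s \<omega> - C21 x y L1 L2 s \<omega>) \<in> borel_measurable (info x y t)"
      if "0 \<le> s" "s \<le> t" for s t
      using surplus_info(2)[OF that] C_info[OF that] by simp
    show "((\<lambda>q. Y y q \<omega> + C12 x y L1 L2 q \<omega> - C21 x y L1 L2 q \<omega>)
        \<longlongrightarrow> Y y s \<omega> + C12 x y L1 L2 s \<omega> - C21 x y L1 L2 s \<omega>) (at_right s)"
      if "\<omega> \<in> space M" "0 \<le> s" for \<omega> s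
      by (intro tendsto_intros two.surplus_right_continuous transfers_right_continuous that)
  qed (use premium_pos in \<open>simp_all add: controlled_Y_def\<close>)
  fix \<omega> assume \<omega>: "\<omega> \<in> space M"
  show "dividend_path (\<lambda>t. run1 n x y L1 L2 t \<omega>)" "dividend_path (\<lambda>t. run2 n x y L1 L2 t \<omega>)"
    using path[OF \<omega>] premium_pos by (auto intro!: switch_at_claim_path)
  let ?T = "ruin_time x y L1 L2 \<omega>"
  let ?T' = "ruin_time x y (run1 n x y L1 L2) (run2 n x y L1 L2) \<omega>"
  have before: "0 \<le> controlled_X x y (run1 n x y L1 L2) (run2 n x y L1 L2) t \<omega> \<and>
      0 \<le> controlled_Y x y (run1 n x y L1 L2) (run2 n x y L1 L2) t \<omega>"
    if t: "0 \<le> t" "ereal t < ?T'" for t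
  proof (cases "?T \<le> claim_time n \<omega>")
    case True
    then have T: "ereal t < ?T" using t(2) by (simp add: ruin_time_switch_of_ruined[OF strat \<omega>])
    then have "ereal t \<le> claim_time n \<omega>" using True by simp
    then show ?thesis
      using strategiesD(5,6)[OF strat \<omega> t(1) T] by (simp add: controlled_switch_before[OF \<omega> t(1)])
  next
    case False
    then obtain s where s: "claim_time n \<omega> = ereal s" "ereal s < ?T" "0 \<le> s"
      using claim_time_nonneg[of n \<omega>] by (cases "claim_time n \<omega>") auto
    show ?thesis
    proof (cases "t \<le> s")
      case True
      then have "ereal t < ?T" using le_less_trans[OF _ s(2), of "ereal t"] by simp
      then show ?thesis
        using strategiesD(5,6)[OF strat \<omega> t(1)] True s(1) by (simp add: controlled_switch_before[OF \<omega> t(1)])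
    next
      case False
      have "\<not> Suc (N1 s \<omega> + N2 s \<omega>) \<le> N1 t \<omega> + N2 t \<omega>"
        using t claim_time_le_iff[OF \<omega> t(1)] by (simp add: ruin_time_switch[OF strat \<omega> s(1,2)] not_le[symmetric])
      then have "N1 t \<omega> + N2 t \<omega> = N1 s \<omega> + N2 s \<omega>"
        using counts_mono[OF \<omega> s(3), of t] False by linarith
      then show ?thesis
        using controlled_after_switch(1)[OF strat \<omega> s(1,2), of t] False by simp
    qed
  qed
  show "0 \<le> controlled_X x y (run1 n x y L1 L2) (run2 n x y L1 L2) t \<omega>"
    "0 \<le> controlled_Y x y (run1 n x y L1 L2) (run2 n x y L1 L2) t \<omega>"
    if "0 \<le> t" "ereal t < ?T'" for t
    using before[OF that] by simp_all
  show "controlled_X x y (run1 n x y L1 L2) (run2 n x y L1 L2) t \<omega> +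
      controlled_Y x y (run1 n x y L1 L2) (run2 n x y L1 L2) t \<omega> < 0" if T': "?T' = ereal t" for t
  proof (cases "?T \<le> claim_time n \<omega>")
    case True
    have "?T = ereal t" using T' by (simp add: ruin_time_switch_of_ruined[OF strat \<omega> True])
    moreover have "0 \<le> t" using calculation ruin_time_nonneg[of x y L1 L2 \<omega>] by simp
    ultimately show ?thesis
      using strategiesD(7)[OF strat \<omega>] True by (simp add: controlled_switch_before[OF \<omega>])
  next
    case False
    then obtain s where s: "claim_time n \<omega> = ereal s" "ereal s < ?T" "0 \<le> s"
      using claim_time_nonneg[of n \<omega>] by (cases "claim_time n \<omega>") auto
    have claim: "claim_time (Suc (N1 s \<omega> + N2 s \<omega>)) \<omega> = ereal t"
      using T' by (simp add: ruin_time_switch[OF strat \<omega> s(1,2)])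
    then have "0 \<le> t" using claim_time_nonneg[of "Suc (N1 s \<omega> + N2 s \<omega>)" \<omega>] by simp
    then have less: "N1 s \<omega> + N2 s \<omega> < N1 t \<omega> + N2 t \<omega>"
      using claim_time_le_iff[OF \<omega>, of t "Suc (N1 s \<omega> + N2 s \<omega>)"] claim by simp
    have "s < t"
      using less counts_mono[OF \<omega> \<open>0 \<le> t\<close>, of s] by linarith
    then show ?thesis
      using controlled_after_switch(2)[OF strat \<omega> s(1,2)] less by simp
  qed
qed

text \<open>The requirement of \<^const>\<open>strategies_n\<close> for one path, with switching time \<open>s\<close>.\<close>

definition runs_from ::
  "real \<Rightarrow> real \<Rightarrow> (real \<Rightarrow> 'w \<Rightarrow> real) \<Rightarrow> (real \<Rightarrow> 'w \<Rightarrow> real) \<Rightarrow> 'w \<Rightarrow> real \<Rightarrow> bool" where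
  "runs_from x y L1 L2 \<omega> s \<longleftrightarrow> (\<forall>t\<ge>s. ereal t \<le> ruin_time x y L1 L2 \<omega> \<longrightarrow>
     L1 t \<omega> = L1 s \<omega> + run_dividends p1 (controlled_X x y L1 L2 s \<omega>) (t - s) \<and>
     L2 t \<omega> = L2 s \<omega> + run_dividends p2 (controlled_Y x y L1 L2 s \<omega>) (t - s))"

lemma strategies_n_iff:
  "(L1, L2) \<in> strategies_n n x y \<longleftrightarrow> (L1, L2) \<in> strategies x y \<and>
     (\<forall>\<omega>\<in>space M. claim_time n \<omega> < ruin_time x y L1 L2 \<omega> \<longrightarrow>
        runs_from x y L1 L2 \<omega> (real_of_ereal (claim_time n \<omega>)))"
  unfolding strategies_n_def runs_from_def Let_def mem_Collect_eq prod.case ..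

lemma switch_in_strategies_n:
  assumes strat: "(L1, L2) \<in> strategies x y"
  shows "(run1 n x y L1 L2, run2 n x y L1 L2) \<in> strategies_n n x y"
  unfolding strategies_n_iff
proof (intro conjI ballI impI switch_in_strategies[OF strat])
  fix \<omega> assume \<omega>: "\<omega> \<in> space M"
    and less: "claim_time n \<omega> < ruin_time x y (run1 n x y L1 L2) (run2 n x y L1 L2) \<omega>"
  obtain s where s: "claim_time n \<omega> = ereal s" "0 \<le> s"
    using less claim_time_nonneg[of n \<omega>] by (cases "claim_time n \<omega>") auto
  have "\<not> ruin_time x y L1 L2 \<omega> \<le> claim_time n \<omega>"
    using less ruin_time_switch_of_ruined[OF strat \<omega>, of n] by auto
  then have "ereal s < ruin_time x y L1 L2 \<omega>"
    using s(1) by simp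
  then have pos: "0 \<le> controlled_X x y L1 L2 s \<omega>" "0 \<le> controlled_Y x y L1 L2 s \<omega>"
    using strategiesD(5,6)[OF strat \<omega> s(2)] by simp_all
  have at: "run1 n x y L1 L2 s \<omega> = L1 s \<omega>" "run2 n x y L1 L2 s \<omega> = L2 s \<omega>"
    using s(1) by (simp_all add: switch_at_claim_before)
  have c: "controlled_X x y (run1 n x y L1 L2) (run2 n x y L1 L2) s \<omega> = controlled_X x y L1 L2 s \<omega>"
    "controlled_Y x y (run1 n x y L1 L2) (run2 n x y L1 L2) s \<omega> = controlled_Y x y L1 L2 s \<omega>"
    using controlled_switch_before(3,4)[OF \<omega> s(2)] s(1) by simp_all
  have "run1 n x y L1 L2 t \<omega> = L1 s \<omega> + run_dividends p1 (controlled_X x y L1 L2 s \<omega>) (t - s)"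
    "run2 n x y L1 L2 t \<omega> = L2 s \<omega> + run_dividends p2 (controlled_Y x y L1 L2 s \<omega>) (t - s)"
    if "s \<le> t" for t
    using that pos at switch_at_claim_after[OF s(1), of t]
    by (cases "s = t"; simp add: run_dividends_def)+
  then have "runs_from x y (run1 n x y L1 L2) (run2 n x y L1 L2) \<omega> s"
    unfolding runs_from_def at c by blast
  then show "runs_from x y (run1 n x y L1 L2) (run2 n x y L1 L2) \<omega> (real_of_ereal (claim_time n \<omega>))"
    using s(1) by simp
qed

text \<open>A strategy that runs after claim \<open>m\<close> is ruined by the next claim, so it can survive claim \<open>n\<close> only
  if that claim arrives at the same time as claim \<open>m\<close>.\<close>

lemma strategies_n_mono:
  assumes "m \<le> n" shows "strategies_n m x y \<subseteq> strategies_n n x y"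
proof safe
  fix L1 L2 assume m: "(L1, L2) \<in> strategies_n m x y"
  then have strat: "(L1, L2) \<in> strategies x y" by (simp add: strategies_n_iff)
  have eq: "claim_time m \<omega> = claim_time n \<omega>"
    if \<omega>: "\<omega> \<in> space M" and less: "claim_time n \<omega> < ruin_time x y L1 L2 \<omega>" for \<omega>
  proof (rule ccontr)
    assume "claim_time m \<omega> \<noteq> claim_time n \<omega>"
    then have lt: "claim_time m \<omega> < claim_time n \<omega>"
      using claim_time_mono[OF assms, of \<omega>] by simp
    obtain t where t: "claim_time n \<omega> = ereal t" "0 \<le> t"
      using less claim_time_nonneg[of n \<omega>] by (cases "claim_time n \<omega>") auto
    obtain s where s: "claim_time m \<omega> = ereal s" "0 \<le> s" "s < t"
      using lt claim_time_nonneg[of m \<omega>] t by (cases "claim_time m \<omega>") auto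
    have "n \<le> N1 t \<omega> + N2 t \<omega>" "\<not> n \<le> N1 s \<omega> + N2 s \<omega>"
      using claim_time_le_iff[OF \<omega>, of t n] claim_time_le_iff[OF \<omega>, of s n] s t by simp_all
    then have "N1 s \<omega> + N2 s \<omega> < N1 t \<omega> + N2 t \<omega>" by simp
    from total_surplus_after_claim[OF \<omega> s(2) less_imp_le[OF s(3)] this, of x y]
    have incr: "X x t \<omega> + Y y t \<omega> < X x s \<omega> + Y y s \<omega> + p1 * (t - s) + p2 * (t - s)" .
    have "claim_time m \<omega> < ruin_time x y L1 L2 \<omega>" using lt less by simp
    then have run: "runs_from x y L1 L2 \<omega> s"
      using m \<omega> s(1) by (auto simp: strategies_n_iff)
    have "L1 t \<omega> = L1 s \<omega> + controlled_X x y L1 L2 s \<omega> + p1 * (t - s)"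
      "L2 t \<omega> = L2 s \<omega> + controlled_Y x y L1 L2 s \<omega> + p2 * (t - s)"
      using run[unfolded runs_from_def, rule_format, of t] s t less by (simp_all add: run_dividends_def)
    then have "controlled_X x y L1 L2 t \<omega> + controlled_Y x y L1 L2 t \<omega> < 0"
      using incr controlled_total[of x y L1 L2 s \<omega>] controlled_total[of x y L1 L2 t \<omega>] by linarith
    then show False
      using strategiesD(5,6)[OF strat \<omega> t(2)] less t(1) by fastforce
  qed
  show "(L1, L2) \<in> strategies_n n x y"
    using m eq unfolding strategies_n_iff by auto
qed

section \<open>Convergence of the values\<close>

lemma borel_measurable_claim_time: "claim_time n \<in> borel_measurable M"
proof (rule borel_measurableI_le)
  fix c :: ereal
  consider "c < 0" | "c = \<infinity>" | t where "c = ereal t" "0 \<le> t"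
    by (cases c) (auto simp: not_le[symmetric])
  then show "{\<omega> \<in> space M. claim_time n \<omega> \<le> c} \<in> sets M"
  proof cases
    case 1
    then have "{\<omega> \<in> space M. claim_time n \<omega> \<le> c} = {}"
      using claim_time_nonneg[of n] by (auto simp: not_le intro: less_le_trans)
    then show ?thesis by (metis sets.empty_sets)
  next
    case 2
    then show ?thesis by simp
  next
    case 3
    have "{\<omega> \<in> space M. claim_time n \<omega> \<le> c} = {\<omega> \<in> space M. n \<le> N1 t \<omega> + N2 t \<omega>}"
      using claim_time_le_iff[OF _ 3(2)] 3(1) by auto
    also have "\<dots> \<in> sets M"
      using info_le[OF counts_info[OF 3(2) order_refl]] by measurable
    finally show ?thesis .
  qed
qed

text \<open>The total surplus grows at most at rate \<open>p1 + p2\<close>. Hence a negative total surplus at time \<open>t\<close> is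
  still negative shortly after \<open>t\<close>, in particular at some rational time.\<close>

lemma borel_measurable_ruin_time:
  assumes strat: "(L1, L2) \<in> strategies x y"
  shows "ruin_time x y L1 L2 \<in> borel_measurable M"
proof (rule borel_measurableI_less)
  fix c :: ereal
  let ?S = "\<lambda>t \<omega>. X x t \<omega> - L1 t \<omega> + (Y y t \<omega> - L2 t \<omega>)"
  let ?Q = "{q \<in> \<rat>. 0 \<le> q \<and> ereal q < c}"
  have "ruin_time x y L1 L2 \<omega> < c \<longleftrightarrow> (\<exists>q\<in>?Q. ?S q \<omega> < 0)" if \<omega>: "\<omega> \<in> space M" for \<omega>
  proof
    assume "ruin_time x y L1 L2 \<omega> < c"
    then obtain t where t: "0 \<le> t" "?S t \<omega> < 0" "ereal t < c"
      unfolding ruin_time_def first_time_less_iff controlled_total by blast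
    have "0 < - ?S t \<omega> / (p1 + p2)"
      using t(2) premium_pos by (intro divide_pos_pos) auto
    then have "ereal t < ereal (t + - ?S t \<omega> / (p1 + p2))" by simp
    with t(3) have "ereal t < min c (ereal (t + - ?S t \<omega> / (p1 + p2)))" by simp
    then obtain r where r: "ereal t < ereal r" "ereal r < min c (ereal (t + - ?S t \<omega> / (p1 + p2)))"
      using ereal_dense2 by blast
    then have "t < r" by simp
    then obtain q where q: "q \<in> \<rat>" "t < q" "q < r" using Rats_dense_in_real by blast
    have "q - t < - ?S t \<omega> / (p1 + p2)" using q r(2) by simp
    then have small: "(p1 + p2) * (q - t) < - ?S t \<omega>"
      using premium_pos by (simp add: pos_less_divide_eq mult.commute)
    have "?S q \<omega> \<le> ?S t \<omega> + (p1 + p2) * (q - t)"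
      using one.surplus_increment_le[OF \<omega> t(1), of q x] two.surplus_increment_le[OF \<omega> t(1), of q y]
        dividend_pathD(2)[OF strategiesD(3)[OF strat \<omega>] t(1), of q]
        dividend_pathD(2)[OF strategiesD(4)[OF strat \<omega>] t(1), of q] q(2)
      by (simp add: distrib_right)
    then have "?S q \<omega> < 0" using small by linarith
    moreover have "ereal q < c"
      using q(3) r(2) by (metis ereal_less_eq(3) less_imp_le min_less_iff_conj order.strict_trans1)
    ultimately show "\<exists>q\<in>?Q. ?S q \<omega> < 0"
      using q t(1) by (intro bexI[of _ q]) auto
  next
    assume "\<exists>q\<in>?Q. ?S q \<omega> < 0"
    then show "ruin_time x y L1 L2 \<omega> < c"
      unfolding ruin_time_def first_time_less_iff controlled_total by blast
  qed
  then have "{\<omega> \<in> space M. ruin_time x y L1 L2 \<omega> < c} = (\<Union>q\<in>?Q. {\<omega> \<in> space M. ?S q \<omega> < 0})"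
    by blast
  also have "\<dots> \<in> sets M"
  proof (intro sets.countable_UN'')
    show "countable ?Q"
      by (rule countable_subset[OF _ countable_rat]) auto
    fix q assume "q \<in> ?Q"
    then have "0 \<le> q" by simp
    note [measurable] = one.borel_measurable_surplus[OF this] two.borel_measurable_surplus[OF this]
      info_le[OF strategies_adapted(1)[OF strat this order_refl]]
      info_le[OF strategies_adapted(2)[OF strat this order_refl]]
    show "{\<omega> \<in> space M. ?S q \<omega> < 0} \<in> sets M" by measurable
  qed
  finally show "{\<omega> \<in> space M. ruin_time x y L1 L2 \<omega> < c} \<in> sets M" .
qed

definition payoff ::
  "real \<Rightarrow> real \<Rightarrow> (real \<Rightarrow> 'w \<Rightarrow> real) \<Rightarrow> (real \<Rightarrow> 'w \<Rightarrow> real) \<Rightarrow> 'w \<Rightarrow> ennreal" where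
  "payoff x y L1 L2 \<omega> =
     (let T = ruin_time x y L1 L2 \<omega> in
        ennreal a1 * (discounted_dividends \<delta> (\<lambda>t. L1 t \<omega>) T +
          discounted_at \<delta> (\<lambda>t. single_value M p1 N1 U1 \<delta> (controlled_X x y L1 L2 t \<omega>)) T) +
        ennreal a2 * (discounted_dividends \<delta> (\<lambda>t. L2 t \<omega>) T +
          discounted_at \<delta> (\<lambda>t. single_value M p2 N2 U2 \<delta> (controlled_Y x y L1 L2 t \<omega>)) T))"

lemma strategy_value_eq: "strategy_value x y L1 L2 = (\<integral>\<^sup>+ \<omega>. payoff x y L1 L2 \<omega> \<partial>M)"
  by (simp add: strategy_value_def payoff_def)

definition weighted_dividends ::
  "(real \<Rightarrow> 'w \<Rightarrow> real) \<Rightarrow> (real \<Rightarrow> 'w \<Rightarrow> real) \<Rightarrow> ereal \<Rightarrow> 'w \<Rightarrow> ennreal" where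
  "weighted_dividends L1 L2 T \<omega> = ennreal a1 * discounted_dividends \<delta> (\<lambda>t. L1 t \<omega>) T +
     ennreal a2 * discounted_dividends \<delta> (\<lambda>t. L2 t \<omega>) T"

lemma weighted_dividends_le_payoff:
  "weighted_dividends L1 L2 (ruin_time x y L1 L2 \<omega>) \<omega> \<le> payoff x y L1 L2 \<omega>"
  by (simp add: weighted_dividends_def payoff_def Let_def add_mono mult_left_mono)

lemma payoff_eq_dividends_if_no_ruin:
  "ruin_time x y L1 L2 \<omega> = \<infinity> \<Longrightarrow> payoff x y L1 L2 \<omega> = weighted_dividends L1 L2 \<infinity> \<omega>"
  by (simp add: weighted_dividends_def payoff_def discounted_at_def)

lemma weighted_dividends_mono:
  assumes "(L1, L2) \<in> strategies x y" "\<omega> \<in> space M" "0 \<le> S" "S \<le> T"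
  shows "weighted_dividends L1 L2 S \<omega> \<le> weighted_dividends L1 L2 T \<omega>"
  unfolding weighted_dividends_def
  using strategiesD(3,4)[OF assms(1,2)] discount_pos assms(3,4)
  by (intro add_mono mult_left_mono discounted_dividends_mono) auto

lemma payoff_switch_of_ruined:
  assumes strat: "(L1, L2) \<in> strategies x y" and \<omega>: "\<omega> \<in> space M"
    and le: "ruin_time x y L1 L2 \<omega> \<le> claim_time n \<omega>"
  shows "payoff x y (run1 n x y L1 L2) (run2 n x y L1 L2) \<omega> = payoff x y L1 L2 \<omega>"
proof -
  let ?T = "ruin_time x y L1 L2 \<omega>"
  note strat' = switch_in_strategies[OF strat, of n]
  have T': "ruin_time x y (run1 n x y L1 L2) (run2 n x y L1 L2) \<omega> = ?T"
    by (rule ruin_time_switch_of_ruined[OF assms])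
  have dd: "discounted_dividends \<delta> (\<lambda>t. run1 n x y L1 L2 t \<omega>) ?T = discounted_dividends \<delta> (\<lambda>t. L1 t \<omega>) ?T"
    "discounted_dividends \<delta> (\<lambda>t. run2 n x y L1 L2 t \<omega>) ?T = discounted_dividends \<delta> (\<lambda>t. L2 t \<omega>) ?T"
    by (rule discounted_dividends_cong,
      use strategiesD(3,4)[OF strat \<omega>] strategiesD(3,4)[OF strat' \<omega>] discount_pos ruin_time_nonneg
        switch_at_claim_before order_trans[OF _ le] in \<open>auto\<close>)+
  have "controlled_X x y (run1 n x y L1 L2) (run2 n x y L1 L2) (real_of_ereal ?T) \<omega>
      = controlled_X x y L1 L2 (real_of_ereal ?T) \<omega> \<and>
    controlled_Y x y (run1 n x y L1 L2) (run2 n x y L1 L2) (real_of_ereal ?T) \<omega>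
      = controlled_Y x y L1 L2 (real_of_ereal ?T) \<omega>" if "?T \<noteq> \<infinity>"
  proof -
    have "ereal (real_of_ereal ?T) = ?T" "0 \<le> real_of_ereal ?T"
      using that ruin_time_nonneg[of x y L1 L2 \<omega>] by (cases ?T; simp)+
    then show ?thesis
      using controlled_switch_before(3,4)[OF \<omega>, of "real_of_ereal ?T" n] le by simp
  qed
  then show ?thesis
    unfolding payoff_def Let_def T' dd by (cases "?T = \<infinity>") (simp_all add: discounted_at_def)
qed

lemma payoff_switch_ge:
  assumes strat: "(L1, L2) \<in> strategies x y" and \<omega>: "\<omega> \<in> space M"
    and less: "claim_time n \<omega> < ruin_time x y L1 L2 \<omega>"
  shows "weighted_dividends L1 L2 (claim_time n \<omega>) \<omega> \<le> payoff x y (run1 n x y L1 L2) (run2 n x y L1 L2) \<omega>"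
proof -
  let ?T' = "ruin_time x y (run1 n x y L1 L2) (run2 n x y L1 L2) \<omega>"
  note strat' = switch_in_strategies[OF strat, of n]
  have dd: "discounted_dividends \<delta> (\<lambda>t. run1 n x y L1 L2 t \<omega>) (claim_time n \<omega>) = discounted_dividends \<delta> (\<lambda>t. L1 t \<omega>) (claim_time n \<omega>)"
    "discounted_dividends \<delta> (\<lambda>t. run2 n x y L1 L2 t \<omega>) (claim_time n \<omega>) = discounted_dividends \<delta> (\<lambda>t. L2 t \<omega>) (claim_time n \<omega>)"
    by (rule discounted_dividends_cong,
      use strategiesD(3,4)[OF strat \<omega>] strategiesD(3,4)[OF strat' \<omega>] discount_pos claim_time_nonneg
        switch_at_claim_before in \<open>auto\<close>)+
  obtain s where s: "claim_time n \<omega> = ereal s" "0 \<le> s"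
    using less claim_time_nonneg[of n \<omega>] by (cases "claim_time n \<omega>") auto
  have "n \<le> N1 s \<omega> + N2 s \<omega>"
    using claim_time_le_iff[OF \<omega> s(2), of n] s(1) by simp
  then have "claim_time n \<omega> \<le> ?T'"
    using ruin_time_switch[OF strat \<omega> s(1)] less s(1) claim_time_mono[of n "Suc (N1 s \<omega> + N2 s \<omega>)" \<omega>] by simp
  then have "weighted_dividends (run1 n x y L1 L2) (run2 n x y L1 L2) (claim_time n \<omega>) \<omega>
      \<le> weighted_dividends (run1 n x y L1 L2) (run2 n x y L1 L2) ?T' \<omega>"
    by (rule weighted_dividends_mono[OF strat' \<omega> claim_time_nonneg])
  also have "\<dots> \<le> payoff x y (run1 n x y L1 L2) (run2 n x y L1 L2) \<omega>"
    by (rule weighted_dividends_le_payoff)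
  finally show ?thesis
    by (simp add: weighted_dividends_def dd)
qed

lemma weighted_dividends_claim_times_SUP:
  assumes strat: "(L1, L2) \<in> strategies x y" and \<omega>: "\<omega> \<in> space M"
  shows "(SUP n. weighted_dividends L1 L2 (claim_time n \<omega>) \<omega>) = weighted_dividends L1 L2 \<infinity> \<omega>"
proof -
  have "incseq (\<lambda>n. claim_time n \<omega>)"
    by (simp add: incseq_def claim_time_mono)
  moreover have "\<exists>n. ereal r \<le> claim_time n \<omega>" for r
    using claim_time_unbounded[OF \<omega>, of r] by (auto intro: less_imp_le)
  ultimately have sup: "dividend_path l \<Longrightarrow>
      (SUP n. discounted_dividends \<delta> l (claim_time n \<omega>)) = discounted_dividends \<delta> l \<infinity>" for l
    using discount_pos claim_time_nonneg by (intro discounted_dividends_SUP)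
  have inc: "incseq (\<lambda>n. ennreal a * discounted_dividends \<delta> l (claim_time n \<omega>))" if "dividend_path l" for l a
    using that discount_pos claim_time_nonneg claim_time_mono
    by (intro incseq_SucI mult_left_mono discounted_dividends_mono) auto
  show ?thesis
    using strategiesD(3,4)[OF strat \<omega>]
    by (simp add: weighted_dividends_def ennreal_SUP_add[OF inc inc] SUP_mult_left_ennreal[symmetric] sup)
qed

text \<open>Whether the payoff is measurable hinges on the value functions paid at ruin. Therefore a simple
  function \<open>g\<close> below the payoff is fixed first, and monotone convergence is applied to measurable
  functions \<open>h n\<close> that increase to \<open>g\<close> and lie below the payoffs of the switched strategies.\<close>

lemma strategy_value_le_SUP_optimal_value_n:
  assumes strat: "(L1, L2) \<in> strategies x y"
  shows "strategy_value x y L1 L2 \<le> (SUP n. optimal_value_n n x y)"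
  unfolding strategy_value_eq nn_integral_def
proof (rule SUP_least)
  fix g assume "g \<in> {g. simple_function M g \<and> g \<le> payoff x y L1 L2}"
  then have g: "simple_function M g" "\<And>\<omega>. g \<omega> \<le> payoff x y L1 L2 \<omega>"
    by (auto simp: le_fun_def)
  have [measurable]: "g \<in> borel_measurable M"
    by (rule borel_measurable_simple_function[OF g(1)])
  note [measurable] = borel_measurable_claim_time borel_measurable_ruin_time[OF strat]
  have [measurable]: "(\<lambda>\<omega>. discounted_dividends \<delta> (\<lambda>t. L1 t \<omega>) (claim_time n \<omega>)) \<in> borel_measurable M"
    "(\<lambda>\<omega>. discounted_dividends \<delta> (\<lambda>t. L2 t \<omega>) (claim_time n \<omega>)) \<in> borel_measurable M" for n
    using strategies_adapted[OF strat _ order_refl, THEN info_le] strategiesD(3,4)[OF strat]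
      borel_measurable_claim_time claim_time_nonneg discount_pos
    by (simp_all add: borel_measurable_discounted_dividends)
  have [measurable]: "(\<lambda>\<omega>. weighted_dividends L1 L2 (claim_time n \<omega>) \<omega>) \<in> borel_measurable M" for n
    unfolding weighted_dividends_def by measurable
  \<comment> \<open>On paths ruined by the time of claim \<open>n\<close> the switch leaves the payoff unchanged; on the others only the dividends so far are secured.\<close>
  define h where "h = (\<lambda>n \<omega>. if ruin_time x y L1 L2 \<omega> \<le> claim_time n \<omega> then g \<omega>
    else min (g \<omega>) (weighted_dividends L1 L2 (claim_time n \<omega>) \<omega>))"
  have h[measurable]: "h n \<in> borel_measurable M" for n
    unfolding h_def by measurable
  have h_le: "h n \<omega> \<le> payoff x y (run1 n x y L1 L2) (run2 n x y L1 L2) \<omega>" if "\<omega> \<in> space M" for n \<omega>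
    using g(2)[of \<omega>] payoff_switch_of_ruined[OF strat that, of n] payoff_switch_ge[OF strat that, of n]
    by (auto simp: h_def not_le intro: min.coboundedI2)
  have h_mono: "h m \<omega> \<le> h n \<omega>" if "\<omega> \<in> space M" "m \<le> n" for m n \<omega>
    using weighted_dividends_mono[OF strat that(1) claim_time_nonneg claim_time_mono[OF that(2)]]
      claim_time_mono[OF that(2), of \<omega>]
    by (auto simp: h_def intro: min.coboundedI2 order_trans)
  have h_sup: "(SUP n. h n \<omega>) = g \<omega>" if \<omega>: "\<omega> \<in> space M" for \<omega>
  proof (rule antisym)
    show "(SUP n. h n \<omega>) \<le> g \<omega>"
      by (rule SUP_least) (simp add: h_def)
    show "g \<omega> \<le> (SUP n. h n \<omega>)"
    proof (cases "ruin_time x y L1 L2 \<omega>")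
      case (real T)
      obtain n where "ereal T < claim_time n \<omega>" using claim_time_unbounded[OF \<omega>] by blast
      then have "h n \<omega> = g \<omega>" using real by (simp add: h_def)
      then show ?thesis by (metis SUP_upper UNIV_I)
    next
      case PInf
      have "g \<omega> = min (g \<omega>) (SUP n. weighted_dividends L1 L2 (claim_time n \<omega>) \<omega>)"
        using g(2)[of \<omega>] payoff_eq_dividends_if_no_ruin[OF PInf]
        by (simp add: weighted_dividends_claim_times_SUP[OF strat \<omega>] min_absorb1)
      also have "\<dots> = (SUP n. min (g \<omega>) (weighted_dividends L1 L2 (claim_time n \<omega>) \<omega>))"
        using inf_Sup[of "g \<omega>"] by (simp add: inf_SUP flip: inf_min)
      also have "\<dots> \<le> (SUP n. h n \<omega>)"
        by (intro SUP_mono') (simp add: h_def)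
      finally show ?thesis .
    qed (use ruin_time_nonneg[of x y L1 L2 \<omega>] in simp)
  qed
  have "integral\<^sup>S M g = (\<integral>\<^sup>+ \<omega>. g \<omega> \<partial>M)"
    by (simp add: nn_integral_eq_simple_integral g(1))
  also have "\<dots> = (\<integral>\<^sup>+ \<omega>. (SUP n. h n \<omega>) \<partial>M)"
    by (rule nn_integral_cong) (simp add: h_sup)
  also have "\<dots> = (SUP n. \<integral>\<^sup>+ \<omega>. h n \<omega> \<partial>M)"
    by (rule nn_integral_monotone_convergence_SUP_AE) (simp_all add: h_mono)
  also have "\<dots> \<le> (SUP n. optimal_value_n n x y)"
  proof (rule SUP_mono')
    fix n
    have "(\<integral>\<^sup>+ \<omega>. h n \<omega> \<partial>M) \<le> strategy_value x y (run1 n x y L1 L2) (run2 n x y L1 L2)"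
      unfolding strategy_value_eq by (intro nn_integral_mono h_le)
    also have "\<dots> \<le> optimal_value_n n x y"
      unfolding optimal_value_n_def
      by (rule SUP_upper2[OF switch_in_strategies_n[OF strat]]) simp
    finally show "(\<integral>\<^sup>+ \<omega>. h n \<omega> \<partial>M) \<le> optimal_value_n n x y" .
  qed
  finally show "integral\<^sup>S M g \<le> (SUP n. optimal_value_n n x y)" .
qed

lemma optimal_value_n_mono: "m \<le> n \<Longrightarrow> optimal_value_n m x y \<le> optimal_value_n n x y"
  unfolding optimal_value_n_def by (intro SUP_subset_mono strategies_n_mono) auto

lemma optimal_value_n_le: "optimal_value_n n x y \<le> optimal_value x y"
  unfolding optimal_value_n_def optimal_value_def
  by (intro SUP_subset_mono) (auto simp: strategies_n_iff)

lemma optimal_value_eq_SUP: "optimal_value x y = (SUP n. optimal_value_n n x y)"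
proof (rule antisym)
  show "optimal_value x y \<le> (SUP n. optimal_value_n n x y)"
    unfolding optimal_value_def by (rule SUP_least) (auto intro: strategy_value_le_SUP_optimal_value_n)
  show "(SUP n. optimal_value_n n x y) \<le> optimal_value x y"
    by (intro SUP_least optimal_value_n_le)
qed

end

theorem proposition19:
  fixes M :: "'w measure"
    and p1 p2 \<kappa>1 \<kappa>2 :: real
    and F1 F2 :: "real \<Rightarrow> real"
    and N1 N2 :: "real \<Rightarrow> 'w \<Rightarrow> nat"
    and U1 U2 :: "nat \<Rightarrow> 'w \<Rightarrow> real"
    and \<delta> a1 a2 x y :: real
  assumes "two_company_model M p1 p2 \<kappa>1 \<kappa>2 F1 F2 N1 N2 U1 U2 \<delta> a1 a2"
    and "0 \<le> x" and "0 \<le> y"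
  defines "V \<equiv> two_company_model.optimal_value M p1 p2 N1 N2 U1 U2 \<delta> a1 a2"
    and "Vn \<equiv> two_company_model.optimal_value_n M p1 p2 N1 N2 U1 U2 \<delta> a1 a2"
  shows "(\<forall>m n. 1 \<le> m \<and> m \<le> n \<longrightarrow> Vn m x y \<le> Vn n x y) \<and>
         (\<lambda>n. Vn n x y) \<longlonglongrightarrow> V x y"
proof -
  interpret two_company_model M p1 p2 \<kappa>1 \<kappa>2 F1 F2 N1 N2 U1 U2 \<delta> a1 a2 by fact
  have "(\<lambda>n. optimal_value_n n x y) \<longlonglongrightarrow> optimal_value x y"
    unfolding optimal_value_eq_SUP
    by (rule LIMSEQ_SUP) (simp add: incseq_def optimal_value_n_mono)
  then show ?thesis
    unfolding V_def Vn_def using optimal_value_n_mono by blast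
qed

end
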